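(* Let $k\ge 1$, $0\le b_0\le k$, $n\ge k$ be integers and let $\lambda$ be a level-$k$ restricted partition of $n$. Then $$\varphi_\lambda(\Gamma_\lambda)=G^{(2)}_\lambda\,\mathcal S_\lambda,$$ where $G_\lambda^{(2)}\mathcal S_\lambda$ is the principal ideal of $\mathcal S_\lambda$ generated by $$G^{(2)}_\lambda=\prod_{a=1}^k\prod_j(x_j^{(a)})^{(a-b_0)_+}\prod_{1\le a<b\le k}\prod_{i,j}(x_i^{(a)}-x_j^{(b)})^{2a}\prod_{a=1}^k\prod_{i<j}(x_i^{(a)}-x_j^{(a)})^{2a}.$$
   Context: $(s)_+=\max(s,0)$. Let $F_n^{(k,2)}$ be the space of symmetric polynomials $f\in\mathbb C[x_1,\dots,x_n]^{\mathfrak S_n}$ such that $f=0$ whenever $x_1=\cdots=x_{k+1}$ and $f=0$ whenever $x_1=\cdots=x_{b_0+1}=0$ (a condition involving more than $n$ variables is void). A partition $\lambda$ of $n$ is level-$k$ restricted if all its parts are $\le k$; $m_a(\lambda)$ denotes the number of parts equal to $a$. Put $\mathcal S_\lambda=\bigotimes_{a=1}^k\mathbb C[x^{(a)}_1,\dots,x^{(a)}_{m_a(\lambda)}]^{\mathfrak S_{m_a(\lambda)}}$. The map $\varphi_\lambda:\mathbb C[x_1,\dots,x_n]^{\mathfrak S_n}\to\mathcal S_\lambda$ is the substitution which partitions the variables $x_1,\dots,x_n$ into groups indexed by $(a,i)$, $1\le a\le k$, $1\le i\le m_a(\lambda)$, the group $(a,i)$ having $a$ elements, and sets every variable of the group $(a,i)$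 equal to $x^{(a)}_i$ (by symmetry the choice of grouping is irrelevant). In $G_\lambda^{(2)}$ the indices $i,j$ run over $1,\dots,m_a(\lambda)$ (resp. $1,\dots,m_b(\lambda)$) for variables with superscript $(a)$ (resp. $(b)$). Lexicographic order: $\nu\succ\lambda$ iff for some $p$, $\nu_j=\lambda_j$ for $j<p$ and $\nu_p>\lambda_p$. Put $\Gamma_\lambda=\bigcap_{\nu\succ\lambda}\big(\operatorname{Ker}\varphi_\nu\cap F_n^{(k,2)}\big)$, where $\nu$ runs over level-$k$ restricted partitions of $n$ (an empty intersection means $F_n^{(k,2)}$). *)

theory Defs
  imports Complex_Main "HOL-Library.Poly_Mapping" "HOL-Combinatorics.Permutations"
begin

text \<open>
  A polynomial over the complex numbers with variables indexed by \<open>'v\<close> is a finitely supported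
  map from monomials to coefficients, a monomial being a finitely supported map from variables to
  exponents. The library's product on \<open>\<Rightarrow>\<^sub>0\<close> is the convolution product, so this type is the
  usual polynomial ring.
\<close>

type_synonym 'v cpoly = "('v \<Rightarrow>\<^sub>0 nat) \<Rightarrow>\<^sub>0 complex"

definition pconst :: "complex \<Rightarrow> 'v cpoly"
  where "pconst c = Poly_Mapping.single 0 c"

definition pvar :: "'v \<Rightarrow> 'v cpoly"
  where "pvar v = Poly_Mapping.single (Poly_Mapping.single v 1) 1"

text \<open>\<open>insertion c s p\<close> replaces each coefficient \<open>z\<close> by \<open>c z\<close> and each variable \<open>v\<close> by \<open>s v\<close>.\<close>

definition insertion ::
    "(complex \<Rightarrow> 'r) \<Rightarrow> ('v \<Rightarrow> 'r) \<Rightarrow> 'v cpoly \<Rightarrow> 'r::comm_ring_1"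
  where "insertion c s p =
    (\<Sum>m\<in>Poly_Mapping.keys p.
       c (Poly_Mapping.lookup p m) * (\<Prod>v\<in>Poly_Mapping.keys m. s v ^ Poly_Mapping.lookup m v))"

definition peval :: "('v \<Rightarrow> complex) \<Rightarrow> 'v cpoly \<Rightarrow> complex"
  where "peval x p = insertion (\<lambda>z. z) x p"

definition psubst :: "('v \<Rightarrow> 'w cpoly) \<Rightarrow> 'v cpoly \<Rightarrow> 'w cpoly"
  where "psubst s p = insertion pconst s p"

definition polys :: "'v set \<Rightarrow> 'v cpoly set"
  where "polys V = {p. \<forall>m\<in>Poly_Mapping.keys p. Poly_Mapping.keys m \<subseteq> V}"

definition sym_polys :: "'v set \<Rightarrow> 'v cpoly set"
  where "sym_polys V =
    {p \<in> polys V. \<forall>\<pi>. \<pi> permutes V \<longrightarrow> psubst (\<lambda>v. pvar (\<pi> v)) p = p}"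

definition F_space :: "nat \<Rightarrow> nat \<Rightarrow> nat \<Rightarrow> nat cpoly set"
  where "F_space k b0 n =
    {f \<in> sym_polys {1..n}.
       (k + 1 \<le> n \<longrightarrow>
          (\<forall>x. (\<forall>i\<in>{1..k + 1}. x i = x 1) \<longrightarrow> peval x f = 0)) \<and>
       (b0 + 1 \<le> n \<longrightarrow>
          (\<forall>x. (\<forall>i\<in>{1..b0 + 1}. x i = 0) \<longrightarrow> peval x f = 0))}"

text \<open>A partition is the weakly decreasing list of its (positive) parts.\<close>

definition restricted_partition :: "nat \<Rightarrow> nat \<Rightarrow> nat list \<Rightarrow> bool"
  where "restricted_partition k n lam \<longleftrightarrow>
    sorted_wrt (\<ge>) lam \<and> (\<forall>a\<in>set lam. 1 \<le> a \<and> a \<le> k) \<and> sum_list lam = n"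

abbreviation mult_part :: "nat \<Rightarrow> nat list \<Rightarrow> nat"
  where "mult_part a lam \<equiv> count_list lam a"

definition part :: "nat list \<Rightarrow> nat \<Rightarrow> nat"
  where "part lam j = (if j < length lam then lam ! j else 0)"

definition lex_greater :: "nat list \<Rightarrow> nat list \<Rightarrow> bool"
  where "lex_greater nu lam \<longleftrightarrow>
    (\<exists>p. (\<forall>j<p. part nu j = part lam j) \<and> part nu p > part lam p)"

text \<open>
  The variable \<open>x\<^bsup>(a)\<^esup>\<^sub>i\<close> is indexed by the pair \<open>(a, i)\<close>. The tensor product of
  the rings of symmetric polynomials in the blocks \<open>x\<^bsup>(a)\<^esup>\<close> is realised inside the polynomial
  ring in all the \<open>x\<^bsup>(a)\<^esup>\<^sub>i\<close> as the set of finite sums of pure tensors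
  \<open>f\<^sub>1 \<otimes> \<dots> \<otimes> f\<^sub>k\<close>, a pure tensor being the product of its factors (which involve
  disjoint sets of variables). An empty block contributes the constants.
\<close>

definition S_ring :: "nat \<Rightarrow> nat list \<Rightarrow> (nat \<times> nat) cpoly set"
  where "S_ring k lam =
    {(\<Sum>t<N. \<Prod>a=1..k. f t a) | (N :: nat) f.
       \<forall>t<N. \<forall>a\<in>{1..k}. f t a \<in> sym_polys ({a} \<times> {1..mult_part a lam})}"

text \<open>
  The substitution needs a grouping of \<open>x\<^sub>1, \<dots>, x\<^sub>n\<close>; it is irrelevant on symmetric
  polynomials which one is taken. Here consecutive variables are grouped: entry \<open>j - 1\<close> of the
  list, whose length is \<open>n\<close> when \<open>lam\<close> is a partition of \<open>n\<close> with parts at most \<open>k\<close>,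
  is the group \<open>(a, i)\<close> of \<open>x\<^sub>j\<close>.
\<close>

definition grouping :: "nat \<Rightarrow> nat list \<Rightarrow> (nat \<times> nat) list"
  where "grouping k lam =
    concat [replicate a (a, i). a \<leftarrow> [1..<k + 1], i \<leftarrow> [1..<mult_part a lam + 1]]"

definition phi :: "nat \<Rightarrow> nat list \<Rightarrow> nat cpoly \<Rightarrow> (nat \<times> nat) cpoly"
  where "phi k lam f = psubst (\<lambda>j. pvar (grouping k lam ! (j - 1))) f"

definition Gamma_space :: "nat \<Rightarrow> nat \<Rightarrow> nat \<Rightarrow> nat list \<Rightarrow> nat cpoly set"
  where "Gamma_space k b0 n lam =
    {f \<in> F_space k b0 n.
       \<forall>nu. restricted_partition k n nu \<and> lex_greater nu lam \<longrightarrow> phi k nu f = 0}"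

text \<open>The exponent \<open>a - b0\<close> is truncated subtraction, i.e. \<open>(a - b0)\<^sub>+\<close>.\<close>

definition G_poly :: "nat \<Rightarrow> nat \<Rightarrow> nat list \<Rightarrow> (nat \<times> nat) cpoly"
  where "G_poly k b0 lam =
    (\<Prod>a=1..k. \<Prod>j=1..mult_part a lam. pvar (a, j) ^ (a - b0)) *
    (\<Prod>b=1..k. \<Prod>a=1..<b. \<Prod>i=1..mult_part a lam. \<Prod>j=1..mult_part b lam.
       (pvar (a, i) - pvar (b, j)) ^ (2 * a)) *
    (\<Prod>a=1..k. \<Prod>j=1..mult_part a lam. \<Prod>i=1..<j.
       (pvar (a, i) - pvar (a, j)) ^ (2 * a))"

end

theory Submission
  imports Defs "HOL-Library.Product_Lexorder" "HOL-Library.Multiset" "HOL-Library.Nat_Bijection"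
begin

text \<open>
  Divisibility. Let \<open>f\<close> lie in the Gamma space, and let \<open>u\<close>, \<open>v\<close> be two groups with \<open>u\<close> not larger
  than \<open>v\<close>. Keep the variables \<open>z\<close> of \<open>u\<close> independent and specialise all other groups. Then \<open>f\<close>
  vanishes as soon as one \<open>z\<close> equals \<open>x\<^sub>v\<close>, because \<open>v\<close> has been enlarged by one element. Since \<open>f\<close> is
  symmetric and vanishes along the diagonal, its partial derivative in \<open>z\<close> vanishes there too, so
  every \<open>z\<close> contributes a factor \<open>(z - x\<^sub>v)\<^sup>2\<close>; putting all \<open>z\<close> equal to \<open>x\<^sub>u\<close> gives the exponent \<open>2a\<close>.
  The power of \<open>x\<^sub>u\<close> comes from the fact that a monomial of \<open>f\<close> omits at most \<open>b0\<close> of the \<open>z\<close>. These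
  factors are powers of pairwise non-associated primes.

  Surjectivity. Arrange \<open>x\<^sub>1, \<dots>, x\<^sub>n\<close> as the cells of the Young diagram of \<open>lam\<close>, the rows being the
  groups. Take the product over the columns of the squared Vandermonde products, times all variables
  in the columns beyond \<open>b0\<close>, times a polynomial \<open>h\<close> that is symmetric in every column, and
  symmetrise. A substitution kills all summands in which a group meets a column twice. For \<open>nu\<close> not
  dominated by \<open>lam\<close> this happens in every summand, and for \<open>lam\<close> itself the remaining summands agree,
  so that the image is a multiple of \<open>G\<close> times the image of \<open>h\<close>. The column power sums give, by
  differences, the power sums of every block, hence all of \<open>S\<close>.
\<close>

section \<open>Polynomials and polynomial functions\<close>

abbreviation "keys \<equiv> Poly_Mapping.keys"
abbreviation "lookup \<equiv> Poly_Mapping.lookup"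
abbreviation "single \<equiv> Poly_Mapping.single"

definition mon_eval :: "('v \<Rightarrow> 'r::comm_ring_1) \<Rightarrow> ('v \<Rightarrow>\<^sub>0 nat) \<Rightarrow> 'r"
  where "mon_eval s m = (\<Prod>v\<in>keys m. s v ^ lookup m v)"

lemma mon_eval_superset:
  assumes "finite V" "keys m \<subseteq> V"
  shows "mon_eval s m = (\<Prod>v\<in>V. s v ^ lookup m v)"
  unfolding mon_eval_def
  by (rule prod.mono_neutral_left) (use assms in \<open>auto simp: in_keys_iff\<close>)

lemma mon_eval_0 [simp]: "mon_eval s 0 = 1"
  by (simp add: mon_eval_def)

lemma mon_eval_add: "mon_eval s (m + m') = mon_eval s m * mon_eval s m'"
proof -
  let ?V = "keys m \<union> keys m'"
  have "mon_eval s (m + m') = (\<Prod>v\<in>?V. s v ^ lookup (m + m') v)"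
    by (rule mon_eval_superset) (use Poly_Mapping.keys_add[of m m'] in auto)
  also have "\<dots> = (\<Prod>v\<in>?V. s v ^ lookup m v) * (\<Prod>v\<in>?V. s v ^ lookup m' v)"
    by (simp add: lookup_add power_add prod.distrib)
  also have "\<dots> = mon_eval s m * mon_eval s m'"
    by (simp add: mon_eval_superset[of ?V])
  finally show ?thesis .
qed

lemma mon_eval_single: "mon_eval s (single v e) = s v ^ e"
  by (cases "e = 0") (simp_all add: mon_eval_def)

lemma poly_mapping_sum_single: "p = (\<Sum>m\<in>keys p. single m (lookup p m))"
  by (rule poly_mapping_eqI) (auto simp: lookup_sum lookup_single when_def in_keys_iff)

lemma poly_mapping_add_induct [case_names zero single add]:
  fixes P :: "('a \<Rightarrow>\<^sub>0 'b::comm_monoid_add) \<Rightarrow> bool"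
  assumes "P 0" and "\<And>m a. P (single m a)" and "\<And>p q. P p \<Longrightarrow> P q \<Longrightarrow> P (p + q)"
  shows "P p"
proof -
  have "P (\<Sum>m\<in>A. single m (lookup p m))" if "finite A" for A
    using that by induction (auto intro: assms)
  then show ?thesis
    by (subst poly_mapping_sum_single) simp
qed

text \<open>Evaluation at a point and substitution of polynomials differ only in where the
  coefficients go. A ring homomorphism on coefficients makes \<open>insertion\<close> a ring
  homomorphism, so one proof serves both.\<close>

locale coeff_hom =
  fixes c :: "complex \<Rightarrow> 'r::comm_ring_1"
  assumes c_0: "c 0 = 0" and c_1: "c 1 = 1"
    and c_add: "c (a + b) = c a + c b" and c_mult: "c (a * b) = c a * c b"
begin

lemma insertion_superset:
  assumes "finite M" "keys p \<subseteq> M"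
  shows "insertion c s p = (\<Sum>m\<in>M. c (lookup p m) * mon_eval s m)"
  unfolding insertion_def mon_eval_def[symmetric]
  by (rule sum.mono_neutral_left) (use assms in \<open>auto simp: in_keys_iff c_0\<close>)

lemma insertion_single [simp]: "insertion c s (single m a) = c a * mon_eval s m"
  by (subst insertion_superset[of "{m}"]) auto

lemma insertion_add [simp]: "insertion c s (p + q) = insertion c s p + insertion c s q"
proof -
  let ?M = "keys p \<union> keys q"
  have "insertion c s (p + q) = (\<Sum>m\<in>?M. c (lookup (p + q) m) * mon_eval s m)"
    by (rule insertion_superset) (use Poly_Mapping.keys_add[of p q] in auto)
  then show ?thesis
    by (simp add: insertion_superset[of ?M] lookup_add c_add distrib_right sum.distrib)
qed

lemma insertion_0 [simp]: "insertion c s 0 = 0"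
  by (simp add: insertion_def)

lemma insertion_1 [simp]: "insertion c s 1 = 1"
  using insertion_single[of s 0 1] by (simp add: c_1)

lemma insertion_mult [simp]: "insertion c s (p * q) = insertion c s p * insertion c s q"
proof (induction p rule: poly_mapping_add_induct)
  case (single m a)
  show ?case
    by (induction q rule: poly_mapping_add_induct)
       (simp_all add: mult_single mon_eval_add c_mult algebra_simps)
qed (simp_all add: algebra_simps)

lemma insertion_diff [simp]: "insertion c s (p - q) = insertion c s p - insertion c s q"
  using insertion_add[of s "p - q" q] by simp

lemma insertion_power [simp]: "insertion c s (p ^ e) = insertion c s p ^ e"
  by (induction e) simp_all

lemma insertion_sum [simp]: "insertion c s (sum f A) = (\<Sum>i\<in>A. insertion c s (f i))"
  by (induction A rule: infinite_finite_induct) simp_all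

lemma insertion_prod [simp]: "insertion c s (prod f A) = (\<Prod>i\<in>A. insertion c s (f i))"
  by (induction A rule: infinite_finite_induct) simp_all

lemma insertion_pvar [simp]: "insertion c s (pvar v) = s v"
  by (simp add: pvar_def mon_eval_single c_1)

lemma insertion_pconst [simp]: "insertion c s (pconst z) = c z"
  by (simp add: pconst_def)

end

lemma pconst_0 [simp]: "pconst 0 = 0" and pconst_1 [simp]: "pconst 1 = 1"
  and pconst_add: "pconst (a + b) = pconst a + pconst b"
  and pconst_mult: "pconst (a * b) = pconst a * pconst b"
  by (simp_all add: pconst_def single_add mult_single)

global_interpretation peval: coeff_hom "\<lambda>z. z"
  rewrites "insertion (\<lambda>z. z) = peval"
proof -
  show "coeff_hom (\<lambda>z. z)"
    by unfold_locales simp_all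
  show "insertion (\<lambda>z. z) = peval"
    by (intro ext) (simp only: peval_def)
qed

global_interpretation psubst: coeff_hom pconst
  rewrites "insertion pconst = psubst"
proof -
  show "coeff_hom pconst"
    by unfold_locales (rule pconst_0 pconst_1 pconst_add pconst_mult)+
  show "insertion pconst = psubst"
    by (intro ext) (simp only: psubst_def)
qed

lemma peval_eq_sum: "peval x p = (\<Sum>m\<in>keys p. lookup p m * mon_eval x m)"
  by (simp add: peval_def insertion_def mon_eval_def)

lemma pvar_power: "pvar v ^ e = single (single v e) 1"
proof (induction e)
  case (Suc e)
  have "single v 1 + single v e = single v (Suc e)"
    by (simp flip: single_add)
  with Suc show ?case
    by (simp add: pvar_def mult_single)
qed simp

lemma mon_eval_pvar: "mon_eval pvar m = single m 1"
proof -
  have "(\<Prod>v\<in>A. pvar v ^ lookup m v) = single (\<Sum>v\<in>A. single v (lookup m v)) 1" if "finite A" for A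
    using that by induction (simp_all add: pvar_power mult_single)
  from this[OF finite_keys[of m]] show ?thesis
    unfolding mon_eval_def using poly_mapping_sum_single[of m] by metis
qed

lemma psubst_pvar: "psubst pvar p = p"
proof (induction p rule: poly_mapping_add_induct)
  case (single m a)
  show ?case
    by (simp only: psubst.insertion_single mon_eval_pvar pconst_def mult_single) simp
qed simp_all

lemma cpoly_induct [case_names const var add mult]:
  assumes const: "\<And>z. P (pconst z)" and var: "\<And>v. P (pvar v)"
    and add: "\<And>p q. P p \<Longrightarrow> P q \<Longrightarrow> P (p + q)" and mult: "\<And>p q. P p \<Longrightarrow> P q \<Longrightarrow> P (p * q)"
  shows "P p"
proof (induction p rule: poly_mapping_add_induct)
  case zero
  show ?case using const[of 0] by simp
next
  case (single m a)
  have "P (pvar v ^ e)" for v e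
    using const[of 1] by (induction e) (auto intro: var mult)
  then have "P (\<Prod>v\<in>A. pvar v ^ lookup m v)" for A
    using const[of 1] by (induction A rule: infinite_finite_induct) (auto intro: mult)
  moreover have "single m a = pconst a * mon_eval pvar m"
    by (simp add: mon_eval_pvar pconst_def mult_single)
  ultimately show ?case
    by (simp add: mon_eval_def const mult)
qed (rule add)

text \<open>Distinct monomials are distinct multiplicative characters; this is Dedekind's argument.\<close>

lemma mon_eval_independent:
  fixes c :: "('v \<Rightarrow>\<^sub>0 nat) \<Rightarrow> complex"
  assumes "finite S" "\<And>x. (\<Sum>m\<in>S. c m * mon_eval x m) = 0" "m \<in> S"
  shows "c m = 0"
  using assms
proof (induction S arbitrary: c m)
  case (insert m0 S)
  have *: "c m = 0" if "m \<in> S" for m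
  proof -
    from that insert have "m \<noteq> m0" by auto
    then obtain v where v: "lookup m v \<noteq> lookup m0 v"
      by (meson poly_mapping_eqI)
    \<comment> \<open>This point separates the two monomials: they take the values
      \<open>2 ^ lookup m v\<close> and \<open>2 ^ lookup m0 v\<close> there.\<close>
    define y :: "'v \<Rightarrow> complex" where "y = (\<lambda>_. 1)(v := 2)"
    have y: "mon_eval y m' = 2 ^ lookup m' v" for m'
    proof -
      have "mon_eval y m' = (\<Prod>u\<in>insert v (keys m'). y u ^ lookup m' u)"
        by (rule mon_eval_superset) auto
      also have "\<dots> = (\<Prod>u\<in>{v}. y u ^ lookup m' u)"
        by (rule prod.mono_neutral_right) (auto simp: y_def)
      finally show ?thesis by (simp add: y_def)
    qed
    have prod: "mon_eval (\<lambda>u. y u * x u) m' = mon_eval y m' * mon_eval x m'" for x m'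
      by (simp add: mon_eval_def power_mult_distrib prod.distrib)
    \<comment> \<open>Subtracting \<open>mon_eval y m0\<close> times the relation at
      \<open>x\<close> from the relation at the pointwise product of \<open>y\<close> and
      \<open>x\<close> removes \<open>m0\<close> and leaves a relation on \<open>S\<close>.\<close>
    have "c m * (mon_eval y m - mon_eval y m0) = 0"
    proof (rule insert.IH[OF _ that, of "\<lambda>m. c m * (mon_eval y m - mon_eval y m0)"])
      fix x :: "'v \<Rightarrow> complex"
      have "(\<Sum>m\<in>insert m0 S. c m * (mon_eval y m - mon_eval y m0) * mon_eval x m)
          = (\<Sum>m\<in>insert m0 S. c m * mon_eval (\<lambda>u. y u * x u) m)
            - mon_eval y m0 * (\<Sum>m\<in>insert m0 S. c m * mon_eval x m)"
        by (simp add: prod sum_distrib_left flip: sum_subtractf) (simp add: algebra_simps)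
      also have "\<dots> = 0"
        using insert.prems(1) by simp
      finally show "(\<Sum>m\<in>S. c m * (mon_eval y m - mon_eval y m0) * mon_eval x m) = 0"
        using insert.hyps by simp
    qed
    moreover have "(2::complex) ^ lookup m v \<noteq> 2 ^ lookup m0 v"
    proof
      assume "(2::complex) ^ lookup m v = 2 ^ lookup m0 v"
      then have "(of_nat (2 ^ lookup m v) :: complex) = of_nat (2 ^ lookup m0 v)" by simp
      then have "(2::nat) ^ lookup m v = 2 ^ lookup m0 v" by (simp only: of_nat_eq_iff)
      with v show False by simp
    qed
    ultimately show ?thesis by (simp add: y)
  qed
  moreover have "c m0 = 0"
    using insert.prems(1)[of "\<lambda>_. 1"] insert.hyps * by (simp add: mon_eval_def)
  ultimately show ?case using insert.prems by auto
qed simp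

text \<open>By independence of the monomials, the values of a polynomial determine its coefficients.
  Polynomial identities are hence checked pointwise, where composing substitutions is plain
  composition.\<close>

lemma peval_eqI:
  assumes "\<And>x. peval x p = peval x q"
  shows "p = q"
proof -
  have "peval x (p - q) = 0" for x
    using assms by simp
  then have "lookup (p - q) m = 0" for m
    using mon_eval_independent[of "keys (p - q)" "lookup (p - q)" m]
    by (cases "m \<in> keys (p - q)") (auto simp: peval_eq_sum in_keys_iff)
  then have "p - q = 0"
    by (intro poly_mapping_eqI) simp
  then show ?thesis by simp
qed

lemma peval_psubst [simp]: "peval x (psubst s p) = peval (\<lambda>v. peval x (s v)) p"
  by (induction p rule: cpoly_induct) simp_all

lemma psubst_psubst: "psubst t (psubst s p) = psubst (\<lambda>v. psubst t (s v)) p"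
  by (rule peval_eqI) simp

lemma psubst_rename: "psubst (\<lambda>v. pvar (t v)) (psubst (\<lambda>v. pvar (s v)) p) = psubst (\<lambda>v. pvar (t (s v))) p"
  by (simp add: psubst_psubst)

section \<open>Polynomials in a prescribed set of variables\<close>

lemma polys_pconst [simp]: "pconst z \<in> polys V"
  by (auto simp: polys_def pconst_def)

lemma polys_0 [simp]: "0 \<in> polys V" and polys_1 [simp]: "1 \<in> polys V"
  using polys_pconst[of 0 V] polys_pconst[of 1 V] by simp_all

lemma polys_pvar [simp]: "v \<in> V \<Longrightarrow> pvar v \<in> polys V"
  by (auto simp: polys_def pvar_def)

lemma polys_add [intro]: "p \<in> polys V \<Longrightarrow> q \<in> polys V \<Longrightarrow> p + q \<in> polys V"
  using Poly_Mapping.keys_add[of p q] by (fastforce simp: polys_def)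

lemma polys_mult [intro]: "p \<in> polys V \<Longrightarrow> q \<in> polys V \<Longrightarrow> p * q \<in> polys V"
proof -
  assume *: "p \<in> polys V" "q \<in> polys V"
  have "keys m \<subseteq> V" if "m \<in> keys (p * q)" for m
  proof -
    from that keys_mult[of p q] obtain a b where ab: "m = a + b" "a \<in> keys p" "b \<in> keys q"
      by auto
    with * Poly_Mapping.keys_add[of a b] show ?thesis by (fastforce simp: polys_def)
  qed
  then show ?thesis by (auto simp: polys_def)
qed

lemma polys_diff [intro]: "p \<in> polys V \<Longrightarrow> q \<in> polys V \<Longrightarrow> p - q \<in> polys V"
proof -
  assume "p \<in> polys V" "q \<in> polys V"
  then have "p + pconst (-1) * q \<in> polys V" by (intro polys_add polys_mult polys_pconst)
  moreover have "p + pconst (-1) * q = p - q"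
    by (rule peval_eqI) simp
  ultimately show ?thesis by simp
qed

lemma polys_power [intro]: "p \<in> polys V \<Longrightarrow> p ^ e \<in> polys V"
  by (induction e) auto

lemma polys_sum [intro]: "(\<And>i. i \<in> A \<Longrightarrow> f i \<in> polys V) \<Longrightarrow> sum f A \<in> polys V"
  by (induction A rule: infinite_finite_induct) auto

lemma polys_prod [intro]: "(\<And>i. i \<in> A \<Longrightarrow> f i \<in> polys V) \<Longrightarrow> prod f A \<in> polys V"
  by (induction A rule: infinite_finite_induct) auto

lemma polys_psubst:
  assumes "p \<in> polys V" "\<And>v. v \<in> V \<Longrightarrow> s v \<in> polys W"
  shows "psubst s p \<in> polys W"
proof -
  have "s v \<in> polys W" if "m \<in> keys p" "v \<in> keys m" for m v
    using assms(1) that by (intro assms(2)) (auto simp: polys_def)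
  then show ?thesis
    unfolding psubst_def insertion_def by (auto intro!: polys_sum polys_mult polys_prod polys_power)
qed

lemma psubst_cong:
  assumes "p \<in> polys V" "\<And>v. v \<in> V \<Longrightarrow> s v = t v"
  shows "psubst s p = psubst t p"
  unfolding psubst_def insertion_def
proof (intro sum.cong prod.cong arg_cong2[where f="(*)"] refl)
  fix m v assume "m \<in> keys p" "v \<in> keys m"
  with assms(1) have "v \<in> V" by (auto simp: polys_def)
  then show "s v ^ lookup m v = t v ^ lookup m v" by (simp add: assms(2))
qed

lemma peval_cong:
  assumes "p \<in> polys V" "\<And>v. v \<in> V \<Longrightarrow> x v = y v"
  shows "peval x p = peval y p"
  unfolding peval_def insertion_def
proof (intro sum.cong prod.cong arg_cong2[where f="(*)"] refl)
  fix m v assume "m \<in> keys p" "v \<in> keys m"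
  with assms(1) have "v \<in> V" by (auto simp: polys_def)
  then show "x v ^ lookup m v = y v ^ lookup m v" by (simp add: assms(2))
qed

lemma sym_polys_iff:
  "p \<in> sym_polys V \<longleftrightarrow>
    p \<in> polys V \<and> (\<forall>\<pi> x. \<pi> permutes V \<longrightarrow> peval (\<lambda>v. x (\<pi> v)) p = peval x p)"
proof -
  have "psubst (\<lambda>v. pvar (\<pi> v)) p = p \<longleftrightarrow> (\<forall>x. peval (\<lambda>v. x (\<pi> v)) p = peval x p)" for \<pi>
  proof
    assume "psubst (\<lambda>v. pvar (\<pi> v)) p = p"
    then have "peval x (psubst (\<lambda>v. pvar (\<pi> v)) p) = peval x p" for x by simp
    then show "\<forall>x. peval (\<lambda>v. x (\<pi> v)) p = peval x p" by simp
  qed (auto intro: peval_eqI)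
  then show ?thesis by (auto simp: sym_polys_def)
qed

subsection \<open>Divisibility by linear forms\<close>

text \<open>Modulo \<open>d\<close> every variable is congruent to its substitute, and congruence
  respects sums and products.\<close>

lemma psubst_dvd:
  assumes "\<And>v. d dvd pvar v - s v"
  shows "d dvd p - psubst s p"
proof (induction p rule: cpoly_induct)
  case (add p q)
  have "p + q - psubst s (p + q) = (p - psubst s p) + (q - psubst s q)" by simp
  with add show ?case by (metis dvd_add)
next
  case (mult p q)
  have "p * q - psubst s (p * q) = (p - psubst s p) * q + psubst s p * (q - psubst s q)"
    by (simp add: algebra_simps)
  with mult show ?case by (metis dvd_add dvd_mult dvd_mult2)
qed (use assms in auto)

text \<open>A linear form \<open>l = x\<^sub>v - s\<close> is prime, being the kernel of the substitution of \<open>s\<close> for \<open>x\<^sub>v\<close>.\<close>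

definition linear_kernel :: "'v cpoly \<Rightarrow> ('v \<Rightarrow> 'v cpoly) \<Rightarrow> bool"
  where "linear_kernel l s \<longleftrightarrow> psubst s l = 0 \<and> (\<forall>v. l dvd pvar v - s v)"

lemma linear_kernel_dvd_iff:
  assumes "linear_kernel l s"
  shows "l dvd p \<longleftrightarrow> psubst s p = 0"
proof
  assume "l dvd p"
  with assms show "psubst s p = 0" by (auto simp: linear_kernel_def dvd_def)
next
  assume "psubst s p = 0"
  with psubst_dvd[of l s p] assms show "l dvd p" by (simp add: linear_kernel_def)
qed

lemma linear_kernel_diff: "linear_kernel (pvar v - pvar w) (pvar(v := pvar w))"
  by (auto simp: linear_kernel_def)

lemma linear_kernel_pvar: "linear_kernel (pvar v) (pvar(v := 0))"
  by (auto simp: linear_kernel_def)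

lemma pvar_diff_dvd_iff:
  "pvar v - pvar w dvd p \<longleftrightarrow> (\<forall>x. x v = x w \<longrightarrow> peval x p = 0)"
proof
  assume *: "\<forall>x. x v = x w \<longrightarrow> peval x p = 0"
  have "psubst (pvar(v := pvar w)) p = 0"
    by (rule peval_eqI) (simp add: *)
  then show "pvar v - pvar w dvd p"
    by (simp add: linear_kernel_dvd_iff[OF linear_kernel_diff])
qed (auto simp: dvd_def)

lemma pvar_dvd_iff: "pvar v dvd p \<longleftrightarrow> (\<forall>x. x v = 0 \<longrightarrow> peval x p = 0)"
proof
  assume *: "\<forall>x. x v = 0 \<longrightarrow> peval x p = 0"
  have "psubst (pvar(v := 0)) p = 0"
    by (rule peval_eqI) (simp add: *)
  then show "pvar v dvd p"
    by (simp add: linear_kernel_dvd_iff[OF linear_kernel_pvar])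
qed (auto simp: dvd_def)

text \<open>The substitution is a homomorphism into an integral domain, so a product is killed only
  with one of its factors. The order on the variables is what orders the monomials and rules out
  zero divisors.\<close>

lemma linear_kernel_prime:
  fixes l :: "'v::linorder cpoly"
  assumes "linear_kernel l s"
  shows "l dvd p * q \<longleftrightarrow> l dvd p \<or> l dvd q"
  by (simp add: linear_kernel_dvd_iff[OF assms])

lemma linear_kernel_power_dvd:
  fixes l :: "'v::linorder cpoly"
  assumes l: "linear_kernel l s" "l \<noteq> 0" and "\<not> l dvd q" "l ^ e dvd q * r"
  shows "l ^ e dvd r"
  using assms(4)
proof (induction e)
  case (Suc e)
  then have "l ^ e dvd q * r" by (metis dvd_mult_right power_Suc)
  with Suc.IH obtain r' where r': "r = l ^ e * r'" by (auto simp: dvd_def)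
  have "l ^ e * l dvd l ^ e * (q * r')"
    using Suc.prems r' by (simp add: ac_simps)
  then have "l dvd q * r'" using \<open>l \<noteq> 0\<close> by simp
  with assms(3) linear_kernel_prime[OF l(1)] have "l dvd r'" by blast
  then show ?case by (simp add: r' mult_dvd_mono)
qed simp

text \<open>Once the other powers are split off, their product is not divisible by the new prime, so
  the whole power of that prime passes to the cofactor. Primality of the factors suffices for
  this.\<close>

lemma prod_linear_powers_dvd:
  fixes l :: "'i \<Rightarrow> 'v::linorder cpoly"
  assumes "finite I" and "\<And>i. i \<in> I \<Longrightarrow> linear_kernel (l i) (s i)" and "\<And>i. i \<in> I \<Longrightarrow> l i \<noteq> 0"
    and "\<And>i j. i \<in> I \<Longrightarrow> j \<in> I \<Longrightarrow> i \<noteq> j \<Longrightarrow> \<not> l i dvd l j"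
    and "\<And>i. i \<in> I \<Longrightarrow> l i ^ e i dvd p"
  shows "(\<Prod>i\<in>I. l i ^ e i) dvd p"
  using assms
proof (induction I)
  case (insert i I)
  have k: "linear_kernel (l i) (s i)" using insert.prems by blast
  have "(\<Prod>i\<in>I. l i ^ e i) dvd p"
    by (rule insert.IH) (use insert.prems in auto)
  then obtain r where r: "p = (\<Prod>i\<in>I. l i ^ e i) * r" by (auto simp: dvd_def)
  have "\<not> l i dvd 1"
    using k insert.prems(2) by (simp add: linear_kernel_dvd_iff)
  then have pow: "\<not> l i dvd l j ^ m" if "j \<in> I" for j m
  proof -
    have "\<not> l i dvd l j"
      by (rule insert.prems(3)) (use that insert.hyps(2) in auto)
    then show ?thesis
    proof (induction m)
      case (Suc m)
      then show ?case by (simp add: linear_kernel_prime[OF k])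
    qed (simp add: \<open>\<not> l i dvd 1\<close>)
  qed
  have "\<not> l i dvd (\<Prod>j\<in>J. l j ^ e j)" if "finite J" "J \<subseteq> I" for J
    using that
  proof induction
    case (insert j J)
    then show ?case using linear_kernel_prime[OF k] pow[of j] by simp
  qed (simp add: \<open>\<not> l i dvd 1\<close>)
  from this[OF insert.hyps(1)] have "\<not> l i dvd (\<Prod>j\<in>I. l j ^ e j)" by simp
  moreover have "l i ^ e i dvd (\<Prod>j\<in>I. l j ^ e j) * r" "l i \<noteq> 0"
    using insert.prems(4)[of i] insert.prems(2)[of i] r by simp_all
  ultimately have "l i ^ e i dvd r"
    using linear_kernel_power_dvd[OF k] by blast
  then show ?case
    using insert.hyps by (simp add: r mult.commute mult_dvd_mono)
qed simp

section \<open>Groupings and partitions\<close>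

definition index_set :: "nat \<Rightarrow> nat list \<Rightarrow> (nat \<times> nat) set"
  where "index_set k lam = (SIGMA a:{1..k}. {1..mult_part a lam})"

definition group_of :: "nat \<Rightarrow> nat list \<Rightarrow> nat \<Rightarrow> nat \<times> nat"
  where "group_of k lam p = grouping k lam ! (p - 1)"

lemma finite_index_set [simp]: "finite (index_set k lam)"
  by (simp add: index_set_def)

lemma fst_index_set: "u \<in> index_set k lam \<Longrightarrow> 1 \<le> fst u \<and> fst u \<le> k"
  by (auto simp: index_set_def)

text \<open>The index set contains \<open>mult_part a nu\<close> pairs with first component
  \<open>a\<close>, so some enumeration of it spells \<open>nu\<close>. This list ties positions in
  the partition to groups.\<close>

lemma ex_index_list:
  assumes "restricted_partition k n nu"
  obtains ls where "distinct ls" "set ls = index_set k nu" "map fst ls = nu"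
proof -
  obtain ls0 where ls0: "set ls0 = index_set k nu" "distinct ls0"
    using finite_distinct_list[OF finite_index_set[of k nu]] by metis
  have "mset (map fst ls0) = mset nu"
  proof (rule multiset_eqI)
    fix a
    have "count (mset (map fst ls0)) a = length (filter (\<lambda>u. a = fst u) ls0)"
      by (simp only: count_mset count_list_eq_length_filter filter_map length_map comp_def)
    also have "\<dots> = card {u \<in> index_set k nu. a = fst u}"
      unfolding ls0(1)[symmetric] set_filter[symmetric]
      by (rule distinct_card[symmetric]) (simp add: ls0)
    also have "{u \<in> index_set k nu. a = fst u} =
        (if a \<in> {1..k} then {a} \<times> {1..mult_part a nu} else {})"
      by (auto simp: index_set_def)
    also have "card \<dots> = count (mset nu) a"
    proof -
      have "mult_part a nu = 0" if "a \<notin> {1..k}"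
        using assms that by (auto simp: restricted_partition_def)
      then show ?thesis by (simp add: count_mset card_cartesian_product)
    qed
    finally show "count (mset (map fst ls0)) a = count (mset nu) a" .
  qed
  then obtain \<sigma> where \<sigma>: "\<sigma> permutes {..<length (map fst ls0)}" "permute_list \<sigma> (map fst ls0) = nu"
    by (metis mset_eq_permutation)
  show ?thesis
  proof
    have \<sigma>': "\<sigma> permutes {..<length ls0}" using \<sigma>(1) by simp
    show "distinct (permute_list \<sigma> ls0)" using \<sigma>' ls0 by simp
    show "set (permute_list \<sigma> ls0) = index_set k nu" using \<sigma>' ls0 by simp
    show "map fst (permute_list \<sigma> ls0) = nu" using \<sigma> \<sigma>' by (simp add: permute_list_map)
  qed
qed

text \<open>Only multisets of values matter to symmetric polynomials, so the order of the grouping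
  list can be forgotten.\<close>

lemma mset_grouping: "mset (grouping k lam) = (\<Sum>u\<in>index_set k lam. replicate_mset (fst u) u)"
proof -
  define ls where "ls = concat (map (\<lambda>a. map (Pair a) [1..<mult_part a lam + 1]) [1..<k + 1])"
  have set_ls: "set ls = index_set k lam"
    by (auto simp: ls_def index_set_def image_iff less_Suc_eq_le simp del: upt_Suc)
  have "distinct (concat (map (\<lambda>a. map (Pair a) [1..<mult_part a lam + 1]) as))" if "distinct as" for as
    using that by (induction as) (auto simp: distinct_map inj_on_def simp del: upt_Suc)
  then have dist: "distinct ls"
    unfolding ls_def by simp
  have "grouping k lam = concat (map (\<lambda>u. replicate (fst u) u) ls)"
    by (simp add: grouping_def ls_def map_concat comp_def)
  then have "mset (grouping k lam) = sum_list (map (\<lambda>u. replicate_mset (fst u) u) ls)"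
    by (simp add: mset_concat comp_def)
  also have "\<dots> = (\<Sum>u\<in>index_set k lam. replicate_mset (fst u) u)"
    using dist set_ls by (simp add: sum_list_distinct_conv_sum_set)
  finally show ?thesis .
qed

lemma size_sum: "size (sum f A :: 'a multiset) = (\<Sum>a\<in>A. size (f a))"
  by (induction A rule: infinite_finite_induct) auto

lemma image_mset_sum: "image_mset g (sum f A) = (\<Sum>a\<in>A. image_mset g (f a))"
  by (induction A rule: infinite_finite_induct) auto

context
  fixes k n lam
  assumes rp: "restricted_partition k n lam"
begin

lemma sum_fst_index_set: "(\<Sum>u\<in>index_set k lam. fst u) = n"
proof -
  obtain ls where "distinct ls" "set ls = index_set k lam" "map fst ls = lam"
    using ex_index_list[OF rp] .
  then show ?thesis
    using rp by (metis restricted_partition_def sum_list_distinct_conv_sum_set)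
qed

lemma length_grouping: "length (grouping k lam) = n"
proof -
  have "size (mset (grouping k lam)) = n"
    by (simp only: mset_grouping size_sum size_replicate_mset sum_fst_index_set)
  then show ?thesis by simp
qed

lemma image_group_of:
  "image_mset (group_of k lam) (mset_set {1..n}) = (\<Sum>u\<in>index_set k lam. replicate_mset (fst u) u)"
proof -
  have "mset (grouping k lam) = mset (map (group_of k lam) [1..<Suc n])"
    by (rule arg_cong[of _ _ mset], rule nth_equalityI)
       (simp_all add: length_grouping group_of_def del: upt_Suc)
  also have "\<dots> = image_mset (group_of k lam) (mset_set {1..n})"
    by (simp only: mset_map mset_upt atLeastLessThanSuc_atLeastAtMost)
  finally show ?thesis by (simp add: mset_grouping)
qed

lemma image_comp_group_of:
  "image_mset (\<lambda>p. x (group_of k lam p)) (mset_set {1..n}) =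
    (\<Sum>u\<in>index_set k lam. replicate_mset (fst u) (x u))"
proof -
  have "image_mset (\<lambda>p. x (group_of k lam p)) (mset_set {1..n}) =
      image_mset x (image_mset (group_of k lam) (mset_set {1..n}))"
    by (simp add: multiset.map_comp comp_def)
  then show ?thesis by (simp only: image_group_of image_mset_sum image_replicate_mset)
qed

lemma group_of_in: "p \<in> {1..n} \<Longrightarrow> group_of k lam p \<in> index_set k lam"
proof -
  assume "p \<in> {1..n}"
  then have "group_of k lam p \<in># image_mset (group_of k lam) (mset_set {1..n})" by simp
  then show ?thesis
    unfolding image_group_of by (auto simp: set_mset_sum split: if_splits)
qed

lemma card_group:
  assumes "u \<in> index_set k lam"
  shows "card {p \<in> {1..n}. group_of k lam p = u} = fst u"
proof -
  have "card {p \<in> {1..n}. group_of k lam p = u} = count (image_mset (group_of k lam) (mset_set {1..n})) u"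
    unfolding count_image_mset by (simp add: vimage_def Int_def conj_commute)
  also have "\<dots> = (\<Sum>v\<in>index_set k lam. if v = u then fst v else 0)"
    unfolding image_group_of by (simp add: count_sum)
  finally show ?thesis using assms by simp
qed

end

section \<open>Symmetric polynomials and multisets of values\<close>

lemma peval_phi: "peval x (phi k lam f) = peval (\<lambda>p. x (group_of k lam p)) f"
  by (simp add: phi_def group_of_def)

lemma sym_peval:
  "f \<in> sym_polys V \<Longrightarrow> \<pi> permutes V \<Longrightarrow> peval (\<lambda>v. x (\<pi> v)) f = peval x f"
  unfolding sym_polys_iff by blast

lemma sym_peval_cong:
  assumes f: "f \<in> sym_polys V" "finite V" and eq: "image_mset x (mset_set V) = image_mset y (mset_set V)"
  shows "peval x f = peval y f"
proof -
  obtain \<pi> where "\<pi> permutes V" "\<forall>v\<in>V. x v = y (\<pi> v)"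
    using image_mset_eq_implies_permutes[OF f(2) eq] by metis
  moreover have "peval x f = peval (\<lambda>v. y (\<pi> v)) f"
    using f(1) calculation(2) by (intro peval_cong[of f V]) (auto simp: sym_polys_def)
  ultimately show ?thesis
    using sym_peval[OF f(1)] by metis
qed

text \<open>Membership in the kernel means vanishing wherever the coordinates fall into constant
  blocks of sizes \<open>nu\<close>, in whatever positions. The pairs in \<open>N\<close> give size
  and value of each block; arranging them along \<open>nu\<close> matches them with the
  groups.\<close>

lemma phi_eq_0_vanish:
  assumes rp: "restricted_partition k n nu" and f: "f \<in> sym_polys {1..n}" and "phi k nu f = 0"
    and N: "image_mset fst N = mset nu"
    and x: "image_mset x (mset_set {1..n}) = (\<Sum>(a, z)\<in>#N. replicate_mset a z)"
  shows "peval x f = 0"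
proof -
  obtain ls where ls: "distinct ls" "set ls = index_set k nu" "map fst ls = nu"
    using ex_index_list[OF rp] .
  obtain ps0 where "mset ps0 = N" using ex_mset by blast
  with N have "mset (map fst ps0) = mset nu" by simp
  then obtain \<sigma> where \<sigma>: "\<sigma> permutes {..<length (map fst ps0)}" "permute_list \<sigma> (map fst ps0) = nu"
    by (metis mset_eq_permutation)
  define ps where "ps = permute_list \<sigma> ps0"
  have ps: "mset ps = N" "map fst ps = nu"
    using \<sigma> \<open>mset ps0 = N\<close> by (simp_all add: ps_def permute_list_map)
  have len: "length ls = length (map snd ps)" using ls ps by (metis length_map)
  define y where "y = (\<lambda>u. the (map_of (zip ls (map snd ps)) u))"
  have "y (ls ! i) = snd (ps ! i)" if "i < length ls" for i
    using that len ls(1) by (simp add: y_def map_of_zip_nth)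
  moreover have "fst (ls ! i) = fst (ps ! i)" if "i < length ls" for i
    using that len ls(3) ps(2) by (metis length_map nth_map)
  ultimately have eq: "map (\<lambda>u. (fst u, y u)) ls = ps"
    using len by (intro nth_equalityI) (auto simp: prod_eq_iff)
  have "(\<Sum>(a, z)\<in>#N. replicate_mset a z) = sum_list (map (\<lambda>(a, z). replicate_mset a z) ps)"
    by (metis mset_map ps(1) sum_mset_sum_list)
  also have "\<dots> = sum_list (map (\<lambda>u. replicate_mset (fst u) (y u)) ls)"
    by (simp add: comp_def flip: eq)
  also have "\<dots> = (\<Sum>u\<in>index_set k nu. replicate_mset (fst u) (y u))"
    using ls by (simp add: sum_list_distinct_conv_sum_set)
  finally have "image_mset x (mset_set {1..n}) =
      image_mset (\<lambda>p. y (group_of k nu p)) (mset_set {1..n})"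
    by (simp only: x image_comp_group_of[OF rp])
  then have "peval x f = peval (\<lambda>p. y (group_of k nu p)) f"
    using f by (intro sym_peval_cong[of f "{1..n}"]) auto
  then show ?thesis
    using \<open>phi k nu f = 0\<close> by (metis peval.insertion_0 peval_phi)
qed

text \<open>The largest part size whose multiplicity differs decides the lexicographic order: after
  the common larger parts and the shared copies of \<open>c\<close>, the list \<open>nu\<close>
  still has a \<open>c\<close> where \<open>lam\<close> has a smaller part or none.\<close>

lemma lex_greater_of_count:
  assumes "sorted_wrt (\<ge>) nu" "sorted_wrt (\<ge>) lam" "c \<ge> 1"
    and "\<And>d. d > c \<Longrightarrow> count_list nu d = count_list lam d" and "count_list nu c > count_list lam c"
  shows "lex_greater nu lam"
  using assms
proof (induction nu arbitrary: lam)
  case (Cons y nu)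
  have c: "c \<in> set (y # nu)"
    using Cons.prems(5) count_list_0_iff[of "y # nu" c] by fastforce
  with Cons.prems(1) have "y \<ge> c" by auto
  show ?case
  proof (cases lam)
    case Nil
    then show ?thesis
      using \<open>y \<ge> c\<close> \<open>c \<ge> 1\<close> by (auto simp: lex_greater_def part_def intro!: exI[of _ 0])
  next
    case (Cons x lam')
    consider "y > x" | "y = x" | "y < x" by linarith
    then show ?thesis
    proof cases
      case 1
      then show ?thesis
        by (auto simp: lex_greater_def part_def Cons intro!: exI[of _ 0])
    next
      case 2
      have "lex_greater nu lam'"
      proof (rule Cons.IH)
        show "count_list nu d = count_list lam' d" if "d > c" for d
          using Cons.prems(4)[OF that] by (auto simp: Cons 2 split: if_splits)
        show "count_list lam' c < count_list nu c"
          using Cons.prems(5) by (auto simp: Cons 2 split: if_splits)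
      qed (use Cons.prems Cons in auto)
      then obtain p where p: "\<forall>j<p. part nu j = part lam' j" "part nu p > part lam' p"
        by (auto simp: lex_greater_def)
      have *: "part (z # zs) (Suc j) = part zs j" "part (z # zs) 0 = z" for z zs j
        by (auto simp: part_def)
      have "\<forall>j<Suc p. part (y # nu) j = part (x # lam') j"
        using p(1) * 2 by (metis less_Suc_eq_0_disj)
      with p(2) show ?thesis
        unfolding lex_greater_def Cons by (metis *(1))
    next
      \<comment> \<open>This case is impossible: \<open>x\<close> exceeds \<open>c\<close>, so its
        multiplicities agree, and \<open>x\<close> would have to occur in a list whose largest entry
        is \<open>y\<close>.\<close>
      case 3
      then have "count_list (y # nu) x = count_list lam x"
        using \<open>y \<ge> c\<close> by (intro Cons.prems(4)) simp
      then have "count_list (y # nu) x > 0"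
        by (simp add: Cons)
      then have "x \<in> set (y # nu)"
        using count_list_0_iff[of "y # nu" x] by fastforce
      with 3 Cons.prems(1) show ?thesis by auto
    qed
  qed
qed simp

text \<open>Membership in \<open>A\<close> and membership in \<open>B\<close> are true equally often
  on \<open>S\<close>, so the two indicator families agree as multisets and a permutation matches
  them.\<close>

lemma ex_permutes_image:
  assumes "finite S" "A \<subseteq> S" "B \<subseteq> S" "card A = card B"
  obtains \<pi> where "\<pi> permutes S" "\<pi> ` A = B"
proof -
  have *: "image_mset (\<lambda>p. p \<in> C) (mset_set S) =
      replicate_mset (card C) True + replicate_mset (card S - card C) False" if "C \<subseteq> S" for C
  proof -
    have fin: "finite C" using that assms(1) finite_subset by blast
    have "mset_set S = mset_set C + mset_set (S - C)"
      using that assms(1) fin by (metis Diff_partition Diff_disjoint finite_Diff mset_set_Union)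
    moreover have "image_mset (\<lambda>p. p \<in> C) (mset_set C) = image_mset (\<lambda>_. True) (mset_set C)"
      by (rule image_mset_cong) (use fin in auto)
    moreover have "image_mset (\<lambda>p. p \<in> C) (mset_set (S - C)) = image_mset (\<lambda>_. False) (mset_set (S - C))"
      by (rule image_mset_cong) (use assms(1) in auto)
    ultimately show ?thesis
      using that fin assms(1) by (simp add: image_mset_const_eq card_Diff_subset)
  qed
  have "image_mset (\<lambda>p. p \<in> A) (mset_set S) = image_mset (\<lambda>p. p \<in> B) (mset_set S)"
    using assms by (simp add: *)
  from image_mset_eq_implies_permutes[OF assms(1) this]
  obtain \<pi> where \<pi>: "\<pi> permutes S" "\<forall>p\<in>S. (p \<in> A) = (\<pi> p \<in> B)" by metis
  have "\<pi> ` A = B"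
  proof
    show "B \<subseteq> \<pi> ` A"
    proof
      fix b assume "b \<in> B"
      with assms(3) have "b \<in> S" by auto
      then obtain p where "p \<in> S" "b = \<pi> p"
        using permutes_image[OF \<pi>(1)] by (metis imageE)
      with \<pi>(2) \<open>b \<in> B\<close> show "b \<in> \<pi> ` A" by auto
    qed
  qed (use \<pi> assms in auto)
  with \<pi>(1) show ?thesis using that by blast
qed

text \<open>A permutation carries the first \<open>k + 1\<close> positions to \<open>B\<close>, so
  symmetry moves the defining condition to any set of that size. The next lemma does the same for
  zeros.\<close>

lemma F_space_vanish_eq:
  assumes "f \<in> F_space k b0 n" "B \<subseteq> {1..n}" "card B = k + 1" "\<And>p q. p \<in> B \<Longrightarrow> q \<in> B \<Longrightarrow> x p = x q"
  shows "peval x f = 0"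
proof -
  have n: "k + 1 \<le> n"
    using card_mono[OF _ assms(2)] assms(3) by simp
  obtain \<pi> where \<pi>: "\<pi> permutes {1..n}" "\<pi> ` {1..k+1} = B"
    using ex_permutes_image[of "{1..n}" "{1..k+1}" B] assms(2,3) n by auto
  have 1: "\<forall>i\<in>{1..k+1}. x (\<pi> i) = x (\<pi> 1)"
    using \<pi>(2) assms(4) by (auto simp del: One_nat_def)
  have 2: "\<forall>x. (\<forall>i\<in>{1..k+1}. x i = x 1) \<longrightarrow> peval x f = 0"
    using assms(1) n unfolding F_space_def by blast
  have "peval (\<lambda>p. x (\<pi> p)) f = 0"
    by (rule mp[OF spec[OF 2, of "\<lambda>p. x (\<pi> p)"] 1])
  moreover have "f \<in> sym_polys {1..n}"
    using assms(1) unfolding F_space_def by blast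
  ultimately show ?thesis using sym_peval[OF _ \<pi>(1)] by metis
qed

lemma F_space_vanish_0:
  assumes "f \<in> F_space k b0 n" "B \<subseteq> {1..n}" "card B = b0 + 1" "\<And>p. p \<in> B \<Longrightarrow> x p = 0"
  shows "peval x f = 0"
proof -
  have n: "b0 + 1 \<le> n"
    using card_mono[OF _ assms(2)] assms(3) by simp
  obtain \<pi> where \<pi>: "\<pi> permutes {1..n}" "\<pi> ` {1..b0+1} = B"
    using ex_permutes_image[of "{1..n}" "{1..b0+1}" B] assms(2,3) n by auto
  have 1: "\<forall>i\<in>{1..b0+1}. x (\<pi> i) = 0"
    using \<pi>(2) assms(4) by auto
  have 2: "\<forall>x. (\<forall>i\<in>{1..b0+1}. x i = 0) \<longrightarrow> peval x f = 0"
    using assms(1) n unfolding F_space_def by blast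
  have "peval (\<lambda>p. x (\<pi> p)) f = 0"
    by (rule mp[OF spec[OF 2, of "\<lambda>p. x (\<pi> p)"] 1])
  moreover have "f \<in> sym_polys {1..n}"
    using assms(1) unfolding F_space_def by blast
  ultimately show ?thesis using sym_peval[OF _ \<pi>(1)] by metis
qed

section \<open>Divisibility by the generator\<close>

text \<open>One family \<open>D\<close> of partial derivatives at \<open>z\<close> has to serve all
  \<open>S\<close>: singletons give the partial derivatives, larger sets a diagonal derivative as
  their sum.\<close>

lemma ex_peval_directional_derivative:
  "\<exists>D. \<forall>S. finite S \<longrightarrow>
    ((\<lambda>t. peval (\<lambda>v. if v \<in> S then z v + t else z v) p) has_field_derivative (\<Sum>v\<in>S. D v)) (at 0)"
proof (induction p rule: cpoly_induct)
  case (const c)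
  show ?case by (rule exI[of _ "\<lambda>_. 0"]) simp
next
  case (var u)
  show ?case
  proof (intro exI allI impI)
    fix S :: "'a set" assume "finite S"
    then show "((\<lambda>t. peval (\<lambda>v. if v \<in> S then z v + t else z v) (pvar u))
      has_field_derivative (\<Sum>v\<in>S. if v = u then 1 else 0)) (at 0)"
      by (cases "u \<in> S") (auto intro!: derivative_eq_intros)
  qed
next
  case (add p q)
  then obtain D E where *: "\<And>S. finite S \<Longrightarrow>
      ((\<lambda>t. peval (\<lambda>v. if v \<in> S then z v + t else z v) p) has_field_derivative (\<Sum>v\<in>S. D v)) (at 0)"
    "\<And>S. finite S \<Longrightarrow>
      ((\<lambda>t. peval (\<lambda>v. if v \<in> S then z v + t else z v) q) has_field_derivative (\<Sum>v\<in>S. E v)) (at 0)"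
    by blast
  show ?case
    by (rule exI[of _ "\<lambda>v. D v + E v"]) (auto simp: sum.distrib intro!: DERIV_add *)
next
  case (mult p q)
  then obtain D E where *: "\<And>S. finite S \<Longrightarrow>
      ((\<lambda>t. peval (\<lambda>v. if v \<in> S then z v + t else z v) p) has_field_derivative (\<Sum>v\<in>S. D v)) (at 0)"
    "\<And>S. finite S \<Longrightarrow>
      ((\<lambda>t. peval (\<lambda>v. if v \<in> S then z v + t else z v) q) has_field_derivative (\<Sum>v\<in>S. E v)) (at 0)"
    by blast
  show ?case
  proof (intro exI allI impI)
    fix S :: "'a set" assume "finite S"
    have "((\<lambda>t. peval (\<lambda>v. if v \<in> S then z v + t else z v) p * peval (\<lambda>v. if v \<in> S then z v + t else z v) q)
      has_field_derivative ((\<Sum>v\<in>S. D v) * peval z q + (\<Sum>v\<in>S. E v) * peval z p)) (at 0)"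
    proof -
      have "(\<lambda>v. if v \<in> S then z v + 0 else z v) = z" by auto
      then show ?thesis
        using DERIV_mult[OF *(1)[OF \<open>finite S\<close>] *(2)[OF \<open>finite S\<close>]] by (simp only:)
    qed
    then show "((\<lambda>t. peval (\<lambda>v. if v \<in> S then z v + t else z v) (p * q))
      has_field_derivative (\<Sum>v\<in>S. D v * peval z q + E v * peval z p)) (at 0)"
      by (simp add: sum.distrib sum_distrib_right)
  qed
qed

text \<open>The partial derivatives along \<open>S\<close> agree by symmetry, and they add up to the derivative
  along the diagonal.\<close>

lemma sym_derivative_eq_0:
  assumes f: "f \<in> sym_polys V" and S: "finite S" "S \<subseteq> V" "i \<in> S"
    and z: "\<And>j. j \<in> S \<Longrightarrow> z j = z i"
    and diag: "\<And>t. peval (\<lambda>v. if v \<in> S then z v + t else z v) f = 0"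
  shows "((\<lambda>t. peval (z(i := z i + t)) f) has_field_derivative 0) (at 0)"
proof -
  obtain D where D: "\<And>S. finite S \<Longrightarrow>
      ((\<lambda>t. peval (\<lambda>v. if v \<in> S then z v + t else z v) f) has_field_derivative (\<Sum>v\<in>S. D v)) (at 0)"
    using ex_peval_directional_derivative[of z f] by blast
  have D1: "((\<lambda>t. peval (z(j := z j + t)) f) has_field_derivative D j) (at 0)" for j
  proof -
    have "(\<lambda>v. if v \<in> {j} then z v + t else z v) = z(j := z j + t)" for t by auto
    then show ?thesis using D[of "{j}"] by simp
  qed
  have "D j = D i" if "j \<in> S" for j
  proof (cases "j = i")
    \<comment> \<open>Exchanging \<open>i\<close> and \<open>j\<close> carries one perturbed point
      to the other, because \<open>z\<close> takes the same value at both.\<close>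
    case False
    let ?\<tau> = "Transposition.transpose i j"
    have "peval (z(j := z j + t)) f = peval (z(i := z i + t)) f" for t
    proof -
      have "?\<tau> permutes V" using that S by (intro permutes_swap_id) auto
      from sym_peval[OF f this, of "z(j := z j + t)"]
      have "peval (z(j := z j + t)) f = peval (\<lambda>v. (z(j := z j + t)) (?\<tau> v)) f" by simp
      also have "(\<lambda>v. (z(j := z j + t)) (?\<tau> v)) = z(i := z i + t)"
        using z[OF that] False by (auto simp: transpose_def fun_eq_iff)
      finally show ?thesis .
    qed
    then have "((\<lambda>t. peval (z(i := z i + t)) f) has_field_derivative D j) (at 0)"
      using D1[of j] by simp
    then show ?thesis
      using D1[of i] by (rule DERIV_unique)
  qed simp
  then have "(\<Sum>v\<in>S. D v) = of_nat (card S) * D i" by simp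
  moreover have "(\<Sum>v\<in>S. D v) = 0"
  proof -
    have "((\<lambda>t. 0) has_field_derivative (\<Sum>v\<in>S. D v)) (at 0)"
      using D[OF S(1)] by (simp only: diag)
    then show ?thesis by (rule DERIV_unique) simp
  qed
  moreover have "card S \<noteq> 0" using S by auto
  ultimately have "D i = 0" by simp
  with D1[of i] show ?thesis by simp
qed

text \<open>Write \<open>p = (pvar u - pvar v) * q\<close>. Moving \<open>x u\<close> by
  \<open>t\<close> away from the hyperplane turns the linear factor into \<open>t\<close>, so the
  derivative at 0 is the value of \<open>q\<close>. Hence \<open>q\<close> vanishes on the
  hyperplane too and supplies the second factor.\<close>

lemma pvar_diff_square_dvd:
  assumes "u \<noteq> v"
    and zero: "\<And>x. x u = x v \<Longrightarrow> peval x p = 0"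
    and der: "\<And>x. x u = x v \<Longrightarrow> ((\<lambda>t. peval (x(u := x u + t)) p) has_field_derivative 0) (at 0)"
  shows "(pvar u - pvar v)\<^sup>2 dvd p"
proof -
  have "pvar u - pvar v dvd p" by (simp add: pvar_diff_dvd_iff zero)
  then obtain q where q: "p = (pvar u - pvar v) * q" by (auto simp: dvd_def)
  have "peval x q = 0" if x: "x u = x v" for x
  proof -
    obtain D where "\<And>S. finite S \<Longrightarrow>
        ((\<lambda>t. peval (\<lambda>w. if w \<in> S then x w + t else x w) q) has_field_derivative (\<Sum>w\<in>S. D w)) (at 0)"
      using ex_peval_directional_derivative[of x q] by blast
    from this[of "{u}"] have "((\<lambda>t. peval (\<lambda>w. if w \<in> {u} then x w + t else x w) q)
        has_field_derivative D u) (at 0)" by simp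
    moreover have "(\<lambda>w. if w \<in> {u} then x w + t else x w) = x(u := x u + t)" for t by auto
    ultimately have "((\<lambda>t. peval (x(u := x u + t)) q) has_field_derivative D u) (at 0)" by simp
    from DERIV_mult[OF DERIV_ident this]
    have "((\<lambda>t. t * peval (x(u := x u + t)) q) has_field_derivative peval x q) (at 0)" by simp
    moreover have "peval (x(u := x u + t)) p = t * peval (x(u := x u + t)) q" for t
      using \<open>u \<noteq> v\<close> x by (simp add: q)
    ultimately show ?thesis
      using der[OF x] DERIV_unique by fastforce
  qed
  then have "pvar u - pvar v dvd q" by (simp add: pvar_diff_dvd_iff)
  then show ?thesis by (simp add: q power2_eq_square mult_dvd_mono)
qed

section \<open>Vanishing on merged groups and orders of divisibility\<close>

context
  fixes k b0 n lam f
  assumes rp: "restricted_partition k n lam" and f: "f \<in> Gamma_space k b0 n lam"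
begin

private abbreviation "V \<equiv> index_set k lam"
private abbreviation "g \<equiv> group_of k lam"
private definition "P u = {p \<in> {1..n}. g p = u}"

private lemma f_F: "f \<in> F_space k b0 n" and f_sym: "f \<in> sym_polys {1..n}"
  and f_polys: "f \<in> polys {1..n}"
  using f unfolding Gamma_space_def F_space_def sym_polys_def by blast+

private lemma P_finite: "finite (P u)" and P_sub: "P u \<subseteq> {1..n}"
  by (auto simp: P_def)

private lemma card_P: "u \<in> V \<Longrightarrow> card (P u) = fst u"
  unfolding P_def by (rule card_group[OF rp])

private lemma mset_P: "mset_set {1..n} = (\<Sum>u\<in>V. mset_set (P u))"
proof (rule multiset_eqI)
  fix p
  have "count (\<Sum>u\<in>V. mset_set (P u)) p = (\<Sum>u\<in>V. if u = g p \<and> p \<in> {1..n} then 1 else 0)"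
    unfolding count_sum
    by (rule sum.cong) (auto simp: P_def count_mset_set')
  also have "\<dots> = count (mset_set {1..n}) p"
    using group_of_in[OF rp, of p] by (auto simp: count_mset_set')
  finally show "count (mset_set {1..n}) p = count (\<Sum>u\<in>V. mset_set (P u)) p" by simp
qed

text \<open>The group \<open>v\<close> together with \<open>q\<close> is a part of size \<open>fst v + 1\<close>; with the rest of \<open>u\<close> split into
  singletons this is a partition that is lexicographically larger than \<open>lam\<close>, unless \<open>fst v = k\<close>.\<close>

private lemma vanish_merge:
  assumes uv: "u \<in> V" "v \<in> V" "u \<noteq> v" "fst u \<le> fst v" and q: "q \<in> P u" "z q = y v"
    and z: "\<And>p. p \<in> {1..n} \<Longrightarrow> g p \<noteq> u \<Longrightarrow> z p = y (g p)"
  shows "peval z f = 0"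
proof (cases "fst v = k")
  \<comment> \<open>A part of size \<open>k + 1\<close> would not be admissible, but now the
    condition on \<open>k + 1\<close> equal variables applies to \<open>q\<close> and the group of
    \<open>v\<close>.\<close>
  case True
  show ?thesis
  proof (rule F_space_vanish_eq[OF f_F])
    show "insert q (P v) \<subseteq> {1..n}" using q P_sub[of u] P_sub[of v] by auto
    show "card (insert q (P v)) = k + 1"
    proof -
      have "q \<notin> P v" using q(1) uv(3) by (auto simp: P_def)
      then show ?thesis using True by (simp add: P_finite card_P[OF uv(2)])
    qed
    have "z p = y v" if "p \<in> insert q (P v)" for p
      using that q(2) z uv(3) by (auto simp: P_def)
    then show "z p = z p'" if "p \<in> insert q (P v)" "p' \<in> insert q (P v)" for p p'
      using that by metis
  qed
next
  case False
  with fst_index_set[OF uv(2)] have v: "1 \<le> fst v" "fst v < k" by auto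
  let ?U = "P u - {q}" and ?W = "V - {u, v}"
  define N where "N = {#(fst v + 1, y v)#} + image_mset (\<lambda>p. (1, z p)) (mset_set ?U)
    + image_mset (\<lambda>w. (fst w, y w)) (mset_set ?W)"
  define nu where "nu = rev (sorted_list_of_multiset (image_mset fst N))"
  have mset_nu: "mset nu = image_mset fst N" by (simp add: nu_def)
  have fstN: "image_mset fst N = {#fst v + 1#} + replicate_mset (card ?U) 1 + image_mset fst (mset_set ?W)"
    by (simp add: N_def multiset.map_comp comp_def image_mset_const_eq P_finite)
  have V_split: "mset_set V = {#u#} + {#v#} + mset_set ?W"
  proof -
    have "V = insert u (insert v ?W)" using uv by auto
    then have "mset_set V = mset_set (insert u (insert v ?W))" by simp
    then show ?thesis using uv by simp
  qed
  have fstV: "image_mset fst (mset_set V) = mset lam"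
  proof -
    obtain ls where "distinct ls" "set ls = V" "map fst ls = lam"
      using ex_index_list[OF rp] .
    then show ?thesis by (metis mset_map mset_set_set)
  qed
  have zN: "image_mset z (mset_set {1..n}) = (\<Sum>(a, w)\<in>#N. replicate_mset a w)"
  proof -
    have const: "image_mset z (mset_set (P w)) = replicate_mset (fst w) (y w)" if "w \<in> V" "w \<noteq> u" for w
    proof -
      have "image_mset z (mset_set (P w)) = image_mset (\<lambda>_. y w) (mset_set (P w))"
        by (rule image_mset_cong) (use that z in \<open>auto simp: P_finite P_def\<close>)
      then show ?thesis using that by (simp add: image_mset_const_eq P_finite card_P)
    qed
    have "image_mset z (mset_set {1..n}) = (\<Sum>w\<in>V. image_mset z (mset_set (P w)))"
      by (simp only: mset_P image_mset_sum)
    also have "\<dots> = image_mset z (mset_set (P u)) + (image_mset z (mset_set (P v)) +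
        (\<Sum>w\<in>?W. image_mset z (mset_set (P w))))"
    proof -
      have "V - {u} - {v} = ?W" by auto
      then show ?thesis
        using uv by (simp add: sum.remove[of V u] sum.remove[of "V - {u}" v])
    qed
    also have "(\<Sum>w\<in>?W. image_mset z (mset_set (P w))) = (\<Sum>w\<in>?W. replicate_mset (fst w) (y w))"
      by (rule sum.cong) (auto simp: const)
    also have "\<dots> = (\<Sum>w\<in>#mset_set ?W. replicate_mset (fst w) (y w))"
      by (simp add: sum_unfold_sum_mset)
    also have "image_mset z (mset_set (P u)) = {#y v#} + image_mset z (mset_set ?U)"
    proof -
      have "mset_set (P u) = {#q#} + mset_set ?U"
        using q(1) by (simp add: P_finite mset_set.remove)
      then show ?thesis using q(2) by simp
    qed
    also have "image_mset z (mset_set ?U) = (\<Sum>p\<in>#mset_set ?U. replicate_mset 1 (z p))"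
      by simp
    finally show ?thesis
      using uv by (simp add: const N_def image_mset.compositionality comp_def)
  qed
  have count_nu: "count_list nu d = count (image_mset fst N) d" for d
    by (metis count_mset mset_nu)
  have count_lam: "count_list lam d = count (image_mset fst (mset_set V)) d" for d
    by (metis count_mset fstV)
  \<comment> \<open>The dissolved parts have sizes at most \<open>fst v\<close> and the new
    singletons have size \<open>1 < fst v + 1\<close>. So from \<open>fst v + 1\<close> upwards only
    the multiplicity of \<open>fst v + 1\<close> changes, and it grows by one.\<close>
  have "lex_greater nu lam"
  proof (rule lex_greater_of_count[where c = "fst v + 1"])
    show "sorted_wrt (\<ge>) nu"
      using sorted_sorted_list_of_multiset[of "image_mset fst N"] by (simp add: nu_def sorted_wrt_rev)
    show "sorted_wrt (\<ge>) lam" using rp by (simp add: restricted_partition_def)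
    show "count_list nu d = count_list lam d" if "d > fst v + 1" for d
      using that uv(4) v unfolding count_nu count_lam fstN V_split by auto
    show "count_list nu (fst v + 1) > count_list lam (fst v + 1)"
      using uv(4) v unfolding count_nu count_lam fstN V_split by auto
  qed simp
  moreover have "restricted_partition k n nu"
    unfolding restricted_partition_def
  proof (intro conjI ballI)
    show "sorted_wrt (\<ge>) nu"
      using sorted_sorted_list_of_multiset[of "image_mset fst N"] by (simp add: nu_def sorted_wrt_rev)
    have "n = size (image_mset z (mset_set {1..n}))" by simp
    also have "\<dots> = sum_mset (image_mset fst N)"
      unfolding zN by (simp add: image_mset.compositionality comp_def case_prod_beta)
    also have "\<dots> = sum_list nu" by (metis mset_nu sum_mset_sum_list)
    finally show "sum_list nu = n" by simp
    fix a assume "a \<in> set nu"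
    then have "a \<in># image_mset fst N" by (metis mset_nu set_mset_mset)
    then show "1 \<le> a" "a \<le> k"
      unfolding fstN using v fst_index_set[of _ k lam] by (auto split: if_splits)
  qed
  ultimately have "phi k nu f = 0"
    using f by (auto simp: Gamma_space_def)
  then show ?thesis
    using phi_eq_0_vanish[OF \<open>restricted_partition k n nu\<close> f_sym _ mset_nu[symmetric] zN] by simp
qed

lemma pvar_diff_power_dvd_phi:
  assumes uv: "u \<in> V" "v \<in> V" "u \<noteq> v" "fst u \<le> fst v"
  shows "(pvar u - pvar v) ^ (2 * fst u) dvd phi k lam f"
proof -
  define r where "r w = Min (P w)" for w
  have r: "r w \<in> P w" if "w \<in> V" for w
    unfolding r_def
    by (rule Min_in) (use that card_P[of w] fst_index_set[of w k lam] in \<open>auto simp: P_finite\<close>)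
  \<comment> \<open>Every group other than \<open>u\<close> is collapsed to one representative, so
    that \<open>F\<close> stays in the original variables while those of \<open>u\<close> remain
    independent.\<close>
  define s where "s p = (if g p = u then p else r (g p))" for p
  define F where "F = psubst (\<lambda>p. pvar (s p)) f"
  have evF: "peval x F = peval (\<lambda>p. x (s p)) f" for x
    by (simp add: F_def)
  have gs: "g (s p) = g p" if "p \<in> {1..n}" for p
    using r[OF group_of_in[OF rp that]] by (auto simp: s_def P_def)
  let ?y = "r v"
  have y: "?y \<in> P v" "?y \<notin> P u" using r[OF uv(2)] uv(3) by (auto simp: P_def)
  have sq: "(pvar q - pvar ?y)\<^sup>2 dvd F" if q: "q \<in> P u" for q
  proof (rule pvar_diff_square_dvd)
    show "q \<noteq> ?y" using q y by auto
    have sp: "x (s p) = x (r (g p))" if "g p \<noteq> u" for p and x :: "nat \<Rightarrow> complex"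
      using that by (simp add: s_def)
    have sq: "s q = q" using q by (auto simp: s_def P_def)
    have merge: "peval (\<lambda>p. x (s p)) f = 0" if "x q = x ?y" for x
      by (rule vanish_merge[OF uv q, where y = "\<lambda>w. x (r w)"]) (use that sp sq in auto)
    then show "peval x F = 0" if "x q = x ?y" for x
      using that by (simp add: evF)
    fix x :: "nat \<Rightarrow> complex"
    assume x: "x q = x ?y"
    let ?S = "insert q (P v)" and ?z = "\<lambda>p. x (s p)"
    have sS: "s p = ?y" if "p \<in> P v" for p
      using that uv(3) by (auto simp: s_def P_def)
    have s_eq: "s p = ?y \<longleftrightarrow> p \<in> P v" if "p \<in> {1..n}" for p
      using that gs[OF that] y sS by (auto simp: P_def)
    have s_eq_q: "s p = q \<longleftrightarrow> p = q" if "p \<in> {1..n}" for p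
      using that gs[OF that] q sq by (auto simp: P_def s_def split: if_splits)
    \<comment> \<open>Moving \<open>q\<close> and the whole group of \<open>v\<close> together
      preserves the merged configuration, so \<open>f\<close> is 0 along that diagonal; by symmetry
      the derivative in \<open>q\<close> alone vanishes.\<close>
    have "((\<lambda>t. peval (?z(q := ?z q + t)) f) has_field_derivative 0) (at 0)"
    proof (rule sym_derivative_eq_0[OF f_sym])
      show "finite ?S" "?S \<subseteq> {1..n}" "q \<in> ?S"
        using q P_sub[of u] P_sub[of v] P_finite by auto
      show "?z p = ?z q" if "p \<in> ?S" for p
        using that sS sq x by auto
      show "peval (\<lambda>p. if p \<in> ?S then ?z p + t else ?z p) f = 0" for t
      proof -
        let ?x = "\<lambda>p. if p \<in> {q, ?y} then x p + t else x p"
        have "peval (\<lambda>p. if p \<in> ?S then ?z p + t else ?z p) f = peval (\<lambda>p. ?x (s p)) f"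
          by (rule peval_cong[OF f_polys]) (use s_eq s_eq_q in auto)
        also have "\<dots> = 0" by (rule merge) (use x in auto)
        finally show ?thesis .
      qed
    qed
    moreover have "peval (x(q := x q + t)) F = peval (?z(q := ?z q + t)) f" for t
      unfolding evF by (rule peval_cong[OF f_polys]) (use s_eq_q sq in auto)
    ultimately show "((\<lambda>t. peval (x(q := x q + t)) F) has_field_derivative 0) (at 0)"
      by simp
  qed
  have "(\<Prod>q\<in>P u. (pvar q - pvar ?y) ^ 2) dvd F"
  proof (rule prod_linear_powers_dvd)
    show "linear_kernel (pvar q - pvar ?y) (pvar(q := pvar ?y))" for q
      by (rule linear_kernel_diff)
    show "\<not> pvar q - pvar ?y dvd pvar q' - pvar ?y" if "q \<in> P u" "q' \<in> P u" "q \<noteq> q'" for q q'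
    proof -
      have "q' \<noteq> ?y" using that y by auto
      then show ?thesis
        unfolding pvar_diff_dvd_iff using that
        by (auto intro!: exI[of _ "\<lambda>p. if p = q' then 1 else 0"])
    qed
    show "pvar q - pvar ?y \<noteq> 0" if "q \<in> P u" for q
    proof -
      have "q \<noteq> ?y" using that y by auto
      then have "peval (\<lambda>p. if p = q then 1 else 0) (pvar q - pvar ?y) \<noteq> 0" by simp
      then show ?thesis by (metis peval.insertion_0)
    qed
  qed (use sq P_finite in auto)
  then obtain H where "F = (\<Prod>q\<in>P u. (pvar q - pvar ?y) ^ 2) * H" by (auto simp: dvd_def)
  \<comment> \<open>Renaming every variable to its group merges the variables of \<open>u\<close>:
    the \<open>fst u\<close> squares become one power, and \<open>F\<close> becomes the image of
    \<open>f\<close> because \<open>s\<close> preserves groups.\<close>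
  then have "psubst (\<lambda>p. pvar (g p)) F =
      (\<Prod>q\<in>P u. (pvar (g q) - pvar (g ?y)) ^ 2) * psubst (\<lambda>p. pvar (g p)) H" by simp
  also have "(\<Prod>q\<in>P u. (pvar (g q) - pvar (g ?y)) ^ 2) = (\<Prod>q\<in>P u. (pvar u - pvar v) ^ 2)"
    by (rule prod.cong) (use y in \<open>auto simp: P_def\<close>)
  also have "\<dots> = (pvar u - pvar v) ^ (2 * fst u)"
    by (simp add: card_P[OF uv(1)] power_mult)
  also have "psubst (\<lambda>p. pvar (g p)) F = phi k lam f"
  proof -
    have "psubst (\<lambda>p. pvar (g p)) F = psubst (\<lambda>p. pvar (g (s p))) f"
      by (simp add: F_def psubst_rename)
    also have "\<dots> = psubst (\<lambda>p. pvar (g p)) f"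
      by (rule psubst_cong[OF f_polys]) (simp only: gs)
    finally show ?thesis by (simp add: phi_def group_of_def)
  qed
  finally show ?thesis by simp
qed

lemma pvar_power_dvd_phi:
  assumes u: "u \<in> V"
  shows "pvar u ^ (fst u - b0) dvd phi k lam f"
proof -
  have "pvar u ^ (fst u - b0) dvd mon_eval (\<lambda>p. pvar (g p)) m" if m: "m \<in> keys f" for m
  proof -
    define Z where "Z = {p \<in> P u. lookup m p = 0}"
    have "finite Z" by (simp add: Z_def P_finite)
    have "card Z \<le> b0"
    proof (rule ccontr)
      assume "\<not> card Z \<le> b0"
      \<comment> \<open>With the \<open>b0 + 1\<close> variables of \<open>B\<close> set to zero,
        \<open>f\<close> vanishes and exactly the monomials free of \<open>B\<close> survive. These
        are independent, so the coefficient of \<open>m\<close> would be zero.\<close>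
      then obtain B where B: "B \<subseteq> Z" "card B = b0 + 1"
        by (metis Suc_eq_plus1 Suc_leI not_le obtain_subset_with_card_n)
      define M where "M = {m \<in> keys f. \<forall>p\<in>B. lookup m p = 0}"
      have "lookup f m = 0"
      proof (rule mon_eval_independent)
        show "finite M" by (simp add: M_def)
        show "m \<in> M" using m B by (auto simp: M_def Z_def)
        fix x :: "nat \<Rightarrow> complex"
        let ?x = "\<lambda>p. if p \<in> B then 0 else x p"
        have "mon_eval ?x m' = (if m' \<in> M then mon_eval x m' else 0)" if "m' \<in> keys f" for m'
        proof (cases "m' \<in> M")
          case True
          then show ?thesis
            by (auto simp: mon_eval_def M_def in_keys_iff intro!: prod.cong)
        next
          case False
          with that obtain p where "p \<in> B" "lookup m' p \<noteq> 0" by (auto simp: M_def)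
          with False show ?thesis
            by (auto simp: mon_eval_def in_keys_iff intro!: bexI[of _ p])
        qed
        then have "peval ?x f = (\<Sum>m\<in>keys f. if m \<in> M then lookup f m * mon_eval x m else 0)"
          unfolding peval_eq_sum by (intro sum.cong) auto
        also have "\<dots> = (\<Sum>m\<in>M. lookup f m * mon_eval x m)"
          by (rule sum.mono_neutral_cong_right) (auto simp: M_def)
        also have "peval ?x f = 0"
          by (rule F_space_vanish_0[OF f_F _ B(2)]) (use B P_sub[of u] in \<open>auto simp: Z_def\<close>)
        finally show "(\<Sum>m\<in>M. lookup f m * mon_eval x m) = 0" by simp
      qed
      with m show False by (simp add: in_keys_iff)
    qed
    then have "fst u - b0 \<le> card (P u - Z)"
      using card_P[OF u] \<open>finite Z\<close> by (simp add: card_Diff_subset Z_def)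
    also have "\<dots> = (\<Sum>p\<in>P u - Z. 1)" by simp
    also have "\<dots> \<le> (\<Sum>p\<in>P u - Z. lookup m p)"
      by (rule sum_mono) (auto simp: Z_def)
    also have "\<dots> \<le> (\<Sum>p\<in>P u. lookup m p)"
      by (rule sum_mono2) (auto simp: P_finite)
    finally have "pvar u ^ (fst u - b0) dvd pvar u ^ (\<Sum>p\<in>P u. lookup m p)"
      by (rule le_imp_power_dvd)
    also have "\<dots> = (\<Prod>p\<in>P u. pvar (g p) ^ lookup m p)"
      by (simp add: power_sum P_def)
    also have "\<dots> dvd (\<Prod>p\<in>{1..n}. pvar (g p) ^ lookup m p)"
      by (rule prod_dvd_prod_subset) (auto simp: P_def)
    also have "\<dots> = mon_eval (\<lambda>p. pvar (g p)) m"
      by (rule mon_eval_superset[symmetric]) (use m f_polys in \<open>auto simp: polys_def\<close>)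
    finally show ?thesis .
  qed
  moreover have "phi k lam f = (\<Sum>m\<in>keys f. pconst (lookup f m) * mon_eval (\<lambda>p. pvar (g p)) m)"
    by (simp add: phi_def psubst_def insertion_def mon_eval_def group_of_def)
  ultimately show ?thesis by (simp add: dvd_sum)
qed

end

section \<open>The generator as a product over ordered pairs, and its block symmetry\<close>

lemma prod_ordered_pairs_permute:
  fixes q :: "'a::linorder \<Rightarrow> 'a \<Rightarrow> 'b::comm_monoid_mult"
  assumes \<pi>: "\<pi> permutes V" and q: "\<And>u v. u \<in> V \<Longrightarrow> v \<in> V \<Longrightarrow> q u v = q v u"
  shows "(\<Prod>(u, v)\<in>{(u, v) \<in> V \<times> V. u < v}. q (\<pi> u) (\<pi> v)) =
    (\<Prod>(u, v)\<in>{(u, v) \<in> V \<times> V. u < v}. q u v)"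
proof (rule prod.reindex_bij_witness)
  \<comment> \<open>The image of an increasing pair may be decreasing; \<open>?o\<close> restores
    the order, which does not affect the symmetric \<open>q\<close>.\<close>
  let ?o = "\<lambda>\<rho> (u, v). if \<rho> u < \<rho> v then (\<rho> u, \<rho> v) else (\<rho> v, \<rho> u)"
  have inj: "\<pi> u = \<pi> v \<longleftrightarrow> u = v" "inv \<pi> u = inv \<pi> v \<longleftrightarrow> u = v" for u v
    using permutes_inj[OF \<pi>] permutes_inj[OF permutes_inv[OF \<pi>]] by (auto simp: inj_eq)
  have inv: "\<pi> (inv \<pi> u) = u" "inv \<pi> (\<pi> u) = u" for u
    using permutes_inverses[OF \<pi>] by auto
  have mem: "\<pi> u \<in> V \<longleftrightarrow> u \<in> V" "inv \<pi> u \<in> V \<longleftrightarrow> u \<in> V" for u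
    using permutes_in_image[OF \<pi>] permutes_in_image[OF permutes_inv[OF \<pi>]] by auto
  fix a assume a: "a \<in> {(u, v) \<in> V \<times> V. u < v}"
  then obtain u v where uv: "a = (u, v)" "u \<in> V" "v \<in> V" "u < v" by auto
  show "?o (inv \<pi>) (?o \<pi> a) = a" "?o \<pi> (?o (inv \<pi>) a) = a"
    using uv by (auto simp: inv)
  show "?o \<pi> a \<in> {(u, v) \<in> V \<times> V. u < v}" "?o (inv \<pi>) a \<in> {(u, v) \<in> V \<times> V. u < v}"
    using uv inj[of u v] by (auto simp: mem not_less less_le)
  show "(case ?o \<pi> a of (u, v) \<Rightarrow> q u v) = (case a of (u, v) \<Rightarrow> q (\<pi> u) (\<pi> v))"
    using uv q[of "\<pi> u" "\<pi> v"] by (auto simp: mem)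
qed

lemma less_nat_pair_iff: "(u :: nat \<times> nat) < v \<longleftrightarrow> fst u < fst v \<or> fst u = fst v \<and> snd u < snd v"
  by (cases u; cases v) auto

text \<open>In the lexicographic order \<open>u < v\<close> means a smaller block, or the same block
  with a smaller index. So the two families of differences merge, and the exponent is twice the
  smaller of the two part sizes.\<close>

lemma G_poly_eq:
  "G_poly k b0 lam = (\<Prod>u\<in>index_set k lam. pvar u ^ (fst u - b0)) *
    (\<Prod>(u, v)\<in>{(u, v) \<in> index_set k lam \<times> index_set k lam. u < v}. (pvar u - pvar v) ^ (2 * fst u))"
proof -
  let ?V = "index_set k lam"
  let ?h = "\<lambda>(u, v). (pvar u - pvar v :: (nat \<times> nat) cpoly) ^ (2 * fst u)"
  let ?D1 = "{(u, v) \<in> ?V \<times> ?V. fst u < fst v}"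
  let ?D2 = "{(u, v) \<in> ?V \<times> ?V. fst u = fst v \<and> snd u < snd v}"
  have 1: "(\<Prod>a=1..k. \<Prod>j=1..mult_part a lam. pvar (a, j) ^ (a - b0)) =
      (\<Prod>u\<in>?V. pvar u ^ (fst u - b0) :: (nat \<times> nat) cpoly)"
    by (simp add: prod.Sigma index_set_def case_prod_beta)
  have 2: "(\<Prod>b=1..k. \<Prod>a=1..<b. \<Prod>i=1..mult_part a lam. \<Prod>j=1..mult_part b lam.
      (pvar (a, i) - pvar (b, j)) ^ (2 * a)) = prod ?h ?D1"
    by (simp add: prod.Sigma, rule prod.reindex_bij_witness
        [of _ "\<lambda>((a, i), (b, j)). (b, a, i, j)" "\<lambda>(b, a, i, j). ((a, i), (b, j))"])
       (auto simp: index_set_def)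
  have 3: "(\<Prod>a=1..k. \<Prod>j=1..mult_part a lam. \<Prod>i=1..<j.
      (pvar (a, i) - pvar (a, j)) ^ (2 * a)) = prod ?h ?D2"
    by (simp add: prod.Sigma, rule prod.reindex_bij_witness
        [of _ "\<lambda>((a, i), (b, j)). (a, j, i)" "\<lambda>(a, j, i). ((a, i), (a, j))"])
       (auto simp: index_set_def)
  have fin: "finite ?D1" "finite ?D2"
    by (rule finite_subset[of _ "?V \<times> ?V"]; force)+
  have "{(u, v) \<in> ?V \<times> ?V. u < v} = ?D1 \<union> ?D2"
    by (auto simp: less_nat_pair_iff)
  moreover have "?D1 \<inter> ?D2 = {}" by auto
  ultimately have "prod ?h {(u, v) \<in> ?V \<times> ?V. u < v} = prod ?h ?D1 * prod ?h ?D2"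
    using fin by (simp add: prod.union_disjoint)
  then show ?thesis
    unfolding G_poly_def 1 2 3 by (simp add: mult.assoc)
qed

text \<open>Invariance under the product of the symmetric groups of the blocks, encoded by single
  permutations of \<open>V\<close>.\<close>

definition block_sym :: "(nat \<times> nat) set \<Rightarrow> (nat \<times> nat) cpoly \<Rightarrow> bool"
  where "block_sym V p \<longleftrightarrow> (\<forall>\<pi> x. \<pi> permutes V \<longrightarrow> (\<forall>u\<in>V. fst (\<pi> u) = fst u) \<longrightarrow>
    peval (\<lambda>u. x (\<pi> u)) p = peval x p)"

lemma block_symD:
  "block_sym V p \<Longrightarrow> \<pi> permutes V \<Longrightarrow> (\<And>u. u \<in> V \<Longrightarrow> fst (\<pi> u) = fst u) \<Longrightarrow>
    peval (\<lambda>u. x (\<pi> u)) p = peval x p"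
  unfolding block_sym_def by blast

lemma block_sym_G_poly: "block_sym (index_set k lam) (G_poly k b0 lam)"
  unfolding block_sym_def
proof (intro allI impI)
  fix \<pi> and x :: "nat \<times> nat \<Rightarrow> complex"
  let ?V = "index_set k lam"
  assume \<pi>: "\<pi> permutes ?V" and fst: "\<forall>u\<in>?V. fst (\<pi> u) = fst u"
  \<comment> \<open>The even exponent and the symmetric \<open>min\<close> make each factor
    independent of the order of its two indices.\<close>
  define q where "q u v = (x u - x v) ^ (2 * min (fst u) (fst v))" for u v
  have q_sym: "q u v = q v u" for u v
    by (simp add: q_def power_mult power2_commute[of "x u"] min.commute)
  have "(\<Prod>(u, v)\<in>{(u, v) \<in> ?V \<times> ?V. u < v}. (x (\<pi> u) - x (\<pi> v)) ^ (2 * fst u)) =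
      (\<Prod>(u, v)\<in>{(u, v) \<in> ?V \<times> ?V. u < v}. q (\<pi> u) (\<pi> v))"
    by (rule prod.cong) (use fst in \<open>auto simp: q_def min_def\<close>)
  also have "\<dots> = (\<Prod>(u, v)\<in>{(u, v) \<in> ?V \<times> ?V. u < v}. q u v)"
    by (rule prod_ordered_pairs_permute[OF \<pi> q_sym])
  also have "\<dots> = (\<Prod>(u, v)\<in>{(u, v) \<in> ?V \<times> ?V. u < v}. (x u - x v) ^ (2 * fst u))"
    by (rule prod.cong) (auto simp: q_def min_def)
  finally have 1: "(\<Prod>(u, v)\<in>{(u, v) \<in> ?V \<times> ?V. u < v}. (x (\<pi> u) - x (\<pi> v)) ^ (2 * fst u)) =
      (\<Prod>(u, v)\<in>{(u, v) \<in> ?V \<times> ?V. u < v}. (x u - x v) ^ (2 * fst u))" .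
  have "(\<Prod>u\<in>?V. x (\<pi> u) ^ (fst u - b0)) = (\<Prod>u\<in>?V. x (\<pi> u) ^ (fst (\<pi> u) - b0))"
    by (rule prod.cong) (use fst in auto)
  also have "\<dots> = (\<Prod>u\<in>?V. x u ^ (fst u - b0))"
    using prod.permute[OF \<pi>, of "\<lambda>u. x u ^ (fst u - b0)"] by (simp add: comp_def)
  finally show "peval (\<lambda>u. x (\<pi> u)) (G_poly k b0 lam) = peval x (G_poly k b0 lam)"
    using 1 by (simp add: G_poly_eq case_prod_beta)
qed

text \<open>Permuting groups of equal size leaves the multiset of the \<open>n\<close> substituted
  values unchanged.\<close>

lemma block_sym_phi:
  assumes "restricted_partition k n lam" "f \<in> sym_polys {1..n}"
  shows "block_sym (index_set k lam) (phi k lam f)"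
  unfolding block_sym_def peval_phi
proof (intro allI impI)
  fix \<pi> and x :: "nat \<times> nat \<Rightarrow> complex"
  let ?V = "index_set k lam"
  assume \<pi>: "\<pi> permutes ?V" and fst: "\<forall>u\<in>?V. fst (\<pi> u) = fst u"
  show "peval (\<lambda>p. x (\<pi> (group_of k lam p))) f = peval (\<lambda>p. x (group_of k lam p)) f"
  proof (rule sym_peval_cong[OF assms(2)])
    have "(\<Sum>u\<in>?V. replicate_mset (fst u) (x (\<pi> u))) = (\<Sum>u\<in>?V. replicate_mset (fst (\<pi> u)) (x (\<pi> u)))"
      by (rule sum.cong) (use fst in auto)
    also have "\<dots> = (\<Sum>u\<in>?V. replicate_mset (fst u) (x u))"
      using sum.permute[OF \<pi>, of "\<lambda>u. replicate_mset (fst u) (x u)"] by (simp add: comp_def)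
    finally show "image_mset (\<lambda>p. x (\<pi> (group_of k lam p))) (mset_set {1..n}) =
        image_mset (\<lambda>p. x (group_of k lam p)) (mset_set {1..n})"
      using image_comp_group_of[OF assms(1), of "\<lambda>u. x (\<pi> u)"]
        image_comp_group_of[OF assms(1), of x] by simp
  qed simp
qed

lemma polys_G_poly: "G_poly k b0 lam \<in> polys (index_set k lam)"
  unfolding G_poly_eq by (auto intro!: polys_mult polys_prod polys_power polys_diff)

lemma polys_phi:
  assumes "restricted_partition k n lam" "f \<in> polys {1..n}"
  shows "phi k lam f \<in> polys (index_set k lam)"
  unfolding phi_def
  by (rule polys_psubst[OF assms(2)])
     (use group_of_in[OF assms(1)] in \<open>auto simp: group_of_def\<close>)

lemma pvar_eq_iff [simp]: "pvar u = pvar v \<longleftrightarrow> u = v"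
proof
  assume "pvar u = pvar v"
  then have "peval (\<lambda>w. if w = u then 1 else 0) (pvar u) = peval (\<lambda>w. if w = u then 1 else 0) (pvar v)"
    by simp
  then show "u = v" by (simp split: if_splits)
qed simp

lemma pvar_neq_0 [simp]: "(pvar u :: 'v cpoly) \<noteq> 0"
proof
  assume "(pvar u :: 'v cpoly) = 0"
  then have "peval (\<lambda>_. 1) (pvar u :: 'v cpoly) = 0" by simp
  then show False by simp
qed

lemma G_poly_neq_0: "G_poly k b0 lam \<noteq> 0"
proof -
  have "finite {(u, v) \<in> index_set k lam \<times> index_set k lam. u < v}"
    by (rule finite_subset[of _ "index_set k lam \<times> index_set k lam"]) auto
  then show ?thesis
    unfolding G_poly_eq by auto
qed

lemma G_poly_dvd_phi:
  assumes rp: "restricted_partition k n lam" and f: "f \<in> Gamma_space k b0 n lam"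
  shows "G_poly k b0 lam dvd phi k lam f"
proof -
  let ?V = "index_set k lam"
  let ?S = "{(u, v) \<in> ?V \<times> ?V. u < v}"
  \<comment> \<open>A diagonal pair stands for the variable itself, a pair \<open>u < v\<close> for
    the difference; this puts all prime factors into one family.\<close>
  define I where "I = {(u, v) \<in> ?V \<times> ?V. u \<le> v}"
  define l :: "(nat \<times> nat) \<times> (nat \<times> nat) \<Rightarrow> (nat \<times> nat) cpoly"
    where "l = (\<lambda>(u, v). if u = v then pvar u else pvar u - pvar v)"
  define s :: "(nat \<times> nat) \<times> (nat \<times> nat) \<Rightarrow> nat \<times> nat \<Rightarrow> (nat \<times> nat) cpoly"
    where "s = (\<lambda>(u, v). pvar(u := if u = v then 0 else pvar v))"
  define e
    where "e i = (case i of (u, v) \<Rightarrow> if u = v then fst u - b0 else 2 * fst u)"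
      for i :: "(nat \<times> nat) \<times> (nat \<times> nat)"
  \<comment> \<open>A point with distinct nonzero coordinates. Changing one coordinate to 0 or to
    the value of another makes exactly one of the primes vanish, so no prime divides
    another.\<close>
  define c where "c w = (of_nat (Suc (prod_encode w)) :: complex)" for w
  have c: "c w \<noteq> 0" "c w = c w' \<longleftrightarrow> w = w'" for w w'
    unfolding c_def of_nat_eq_iff by (simp_all del: of_nat_Suc)
  have fin: "finite I" "finite ?S"
    by (rule finite_subset[of _ "?V \<times> ?V"]; force simp: I_def)+
  have "(\<Prod>i\<in>I. l i ^ e i) dvd phi k lam f"
  proof (rule prod_linear_powers_dvd[OF fin(1)])
    fix i assume i: "i \<in> I"
    then obtain u v where uv: "i = (u, v)" "u \<in> ?V" "v \<in> ?V" "u \<le> v" by (auto simp: I_def)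
    show "linear_kernel (l i) (s i)"
      using linear_kernel_pvar[of u] linear_kernel_diff[of u v] by (auto simp: l_def s_def uv)
    show "l i \<noteq> 0" by (simp add: uv l_def)
    show "l i ^ e i dvd phi k lam f"
      using pvar_power_dvd_phi[OF rp f uv(2)] pvar_diff_power_dvd_phi[OF rp f uv(2,3)] uv(4)
      by (auto simp: uv(1) l_def e_def less_nat_pair_iff le_less)
    fix j assume j: "j \<in> I" "i \<noteq> j"
    then obtain a b where ab: "j = (a, b)" "a \<in> ?V" "b \<in> ?V" "a \<le> b" by (auto simp: I_def)
    show "\<not> l i dvd l j"
    proof (cases "u = v")
      case True
      have "peval (c(u := 0)) (l j) \<noteq> 0"
        using j uv ab True c by (auto simp: l_def)
      then show ?thesis
        unfolding uv l_def using True by (auto simp: pvar_dvd_iff intro!: exI[of _ "c(u := 0)"])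
    next
      case False
      have "peval (c(v := c u)) (l j) \<noteq> 0"
        using j uv ab False c by (auto simp: l_def)
      then show ?thesis
        unfolding uv l_def using False by (auto simp: pvar_diff_dvd_iff intro!: exI[of _ "c(v := c u)"])
    qed
  qed
  also have "I = (\<lambda>u. (u, u)) ` ?V \<union> ?S" by (auto simp: I_def)
  also have "(\<Prod>i\<in>(\<lambda>u. (u, u)) ` ?V \<union> ?S. l i ^ e i) =
      (\<Prod>i\<in>(\<lambda>u. (u, u)) ` ?V. l i ^ e i) * (\<Prod>i\<in>?S. l i ^ e i)"
    by (rule prod.union_disjoint) (use fin in auto)
  also have "(\<Prod>i\<in>(\<lambda>u. (u, u)) ` ?V. l i ^ e i) = (\<Prod>u\<in>?V. pvar u ^ (fst u - b0))"
    by (subst prod.reindex) (auto simp: inj_on_def l_def e_def)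
  also have "(\<Prod>i\<in>?S. l i ^ e i) = (\<Prod>(u, v)\<in>?S. (pvar u - pvar v) ^ (2 * fst u))"
    by (rule prod.cong) (auto simp: l_def e_def)
  finally show ?thesis by (simp add: G_poly_eq)
qed

section \<open>Block-symmetric polynomials\<close>

lemma sum_permutations_sym:
  assumes "finite W" "p \<in> polys W"
  shows "(\<Sum>\<pi> | \<pi> permutes W. psubst (\<lambda>v. pvar (\<pi> v)) p) \<in> sym_polys W"
  unfolding sym_polys_iff
proof (intro conjI allI impI)
  show "(\<Sum>\<pi> | \<pi> permutes W. psubst (\<lambda>v. pvar (\<pi> v)) p) \<in> polys W"
    by (intro polys_sum polys_psubst[OF assms(2)]) (auto simp: permutes_in_image)
  fix \<sigma> and x :: "'a \<Rightarrow> complex" assume \<sigma>: "\<sigma> permutes W"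
  have "(\<Sum>\<pi> | \<pi> permutes W. peval (\<lambda>v. x (\<pi> v)) p) =
      (\<Sum>\<pi> | \<pi> permutes W. peval (\<lambda>v. x ((\<sigma> \<circ> \<pi>) v)) p)"
    by (rule setum_permutations_compose_left[OF \<sigma>])
  then show "peval (\<lambda>v. x (\<sigma> v)) (\<Sum>\<pi> | \<pi> permutes W. psubst (\<lambda>v. pvar (\<pi> v)) p) =
      peval x (\<Sum>\<pi> | \<pi> permutes W. psubst (\<lambda>v. pvar (\<pi> v)) p)"
    by (simp add: comp_def)
qed

lemma sym_polys_smult: "p \<in> sym_polys W \<Longrightarrow> pconst c * p \<in> sym_polys W"
  unfolding sym_polys_iff by (auto intro: polys_mult)

lemma sum_permutations_eq:
  assumes "finite W" "\<And>\<pi>. \<pi> permutes W \<Longrightarrow> psubst (\<lambda>v. pvar (\<pi> v)) p = p"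
  shows "p = pconst (1 / fact (card W)) * (\<Sum>\<pi> | \<pi> permutes W. psubst (\<lambda>v. pvar (\<pi> v)) p)"
proof -
  have "(\<Sum>\<pi> | \<pi> permutes W. psubst (\<lambda>v. pvar (\<pi> v)) p) = (\<Sum>\<pi> | \<pi> permutes W. p)"
    by (rule sum.cong) (auto simp: assms(2))
  also have "\<dots> = of_nat (fact (card W)) * p"
    using assms(1) by (simp add: card_permutations)
  finally have *: "(\<Sum>\<pi> | \<pi> permutes W. psubst (\<lambda>v. pvar (\<pi> v)) p) = of_nat (fact (card W)) * p" .
  have "peval x (of_nat m) = of_nat m" for x m
    by (induction m) simp_all
  then have ev: "peval x (fact m) = fact m" for x m
    by (metis of_nat_fact)
  show ?thesis
    unfolding * by (rule peval_eqI) (simp add: ev)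
qed

text \<open>Monomials split into one factor per block, which gives a sum of pure products. Averaging
  over the permutations of one block after another makes the factors of that block symmetric without
  changing \<open>h\<close>; \<open>A\<close> collects the blocks already treated.\<close>

lemma S_ringI:
  assumes k: "k \<ge> 1" and h: "h \<in> polys (index_set k lam)"
    and sym: "\<And>a \<pi>. a \<in> {1..k} \<Longrightarrow> \<pi> permutes {a} \<times> {1..mult_part a lam} \<Longrightarrow>
      psubst (\<lambda>v. pvar (\<pi> v)) h = h"
  shows "h \<in> S_ring k lam"
proof -
  let ?B = "\<lambda>a. {a} \<times> {1..mult_part a lam}"
  have "\<exists>(N :: nat) f. h = (\<Sum>t<N. \<Prod>a=1..k. f t a) \<and>
      (\<forall>t<N. \<forall>a\<in>{1..k}. f t a \<in> (if a \<in> A then sym_polys (?B a) else polys (?B a)))"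
    if "finite A" "A \<subseteq> {1..k}" for A
    using that
  proof induction
    case empty
    obtain e where e: "bij_betw e {..<card (keys h)} (keys h)"
      using ex_bij_betw_nat_finite[OF finite_keys] by (metis atLeast0LessThan)
    \<comment> \<open>The coefficient of a monomial goes to the factor of block 1, which exists
      since \<open>k \<ge> 1\<close>.\<close>
    define f where "f t a = pconst (if a = 1 then lookup h (e t) else 1) *
      (\<Prod>u\<in>?B a. pvar u ^ lookup (e t) u)" for t a
    have "h = (\<Sum>m\<in>keys h. single m (lookup h m))" by (rule poly_mapping_sum_single)
    also have "\<dots> = (\<Sum>t<card (keys h). single (e t) (lookup h (e t)))"
      by (rule sum.reindex_bij_betw[OF e, symmetric])
    also have "\<dots> = (\<Sum>t<card (keys h). \<Prod>a=1..k. f t a)"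
    proof (rule sum.cong[OF refl])
      fix t assume "t \<in> {..<card (keys h)}"
      with e have "e t \<in> keys h" by (auto simp: bij_betw_def)
      with h have sub: "keys (e t) \<subseteq> index_set k lam" by (auto simp: polys_def)
      have "single (e t) (lookup h (e t)) = pconst (lookup h (e t)) * mon_eval pvar (e t)"
        by (simp only: mon_eval_pvar pconst_def mult_single) simp
      also have "mon_eval pvar (e t) = (\<Prod>u\<in>index_set k lam. pvar u ^ lookup (e t) u)"
        by (rule mon_eval_superset[OF _ sub]) simp
      also have "\<dots> = (\<Prod>a=1..k. \<Prod>u\<in>?B a. pvar u ^ lookup (e t) u)"
      proof -
        have "(\<Prod>u\<in>?B a. pvar u ^ lookup (e t) u :: (nat \<times> nat) cpoly) =
            (\<Prod>i=1..mult_part a lam. pvar (a, i) ^ lookup (e t) (a, i))" for a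
          by (rule prod.reindex_bij_witness[of _ "Pair a" snd]) auto
        then show ?thesis
          by (simp add: index_set_def prod.Sigma case_prod_beta)
      qed
      also have "(pconst (lookup h (e t)) :: (nat \<times> nat) cpoly) = (\<Prod>a=1..k. pconst (if a = 1 then lookup h (e t) else 1))"
      proof -
        have "(\<Prod>a=1..k. pconst (if a = 1 then lookup h (e t) else 1)) =
            (\<Prod>a=1..k. if a = 1 then pconst (lookup h (e t)) else 1 :: (nat \<times> nat) cpoly)"
          by (rule prod.cong) auto
        then show ?thesis using k by simp
      qed
      finally show "single (e t) (lookup h (e t)) = (\<Prod>a=1..k. f t a)"
        by (simp add: f_def prod.distrib)
    qed
    finally have eq: "h = (\<Sum>t<card (keys h). \<Prod>a=1..k. f t a)" .
    have mem: "f t a \<in> polys (?B a)" for t a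
      unfolding f_def by (intro polys_mult polys_prod polys_power) auto
    show ?case
    proof (intro exI conjI)
      show "h = (\<Sum>t<card (keys h). \<Prod>a=1..k. f t a)" by (rule eq)
      show "\<forall>t<card (keys h). \<forall>a\<in>{1..k}. f t a \<in> (if a \<in> {} then sym_polys (?B a) else polys (?B a))"
        using mem by simp
    qed
  next
    case (insert b A)
    from insert.prems have "A \<subseteq> {1..k}" by simp
    from insert.IH[OF this] obtain N :: nat and f where f1: "h = (\<Sum>t<N. \<Prod>a=1..k. f t a)"
      and f2: "\<forall>t<N. \<forall>a\<in>{1..k}. f t a \<in> (if a \<in> A then sym_polys (?B a) else polys (?B a))"
      by (elim exE conjE)
    note f = f1 f2[rule_format]
    have b: "b \<in> {1..k}" using insert by auto
    have f_polys: "f t a \<in> polys (?B a)" if "t < N" "a \<in> {1..k}" for t a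
      using f(2)[OF that] by (auto simp: sym_polys_def split: if_splits)
    let ?P = "{\<pi>. \<pi> permutes ?B b}"
    define c :: complex where "c = 1 / fact (card (?B b))"
    \<comment> \<open>Averaging over block \<open>b\<close> acts only on the factor with index
      \<open>b\<close>, as the others contain no variable of that block.\<close>
    define f' where "f' t a = (if a = b then pconst c * (\<Sum>\<pi>\<in>?P. psubst (\<lambda>v. pvar (\<pi> v)) (f t b)) else f t a)"
      for t a
    have other: "psubst (\<lambda>v. pvar (\<pi> v)) (f t a) = f t a"
      if "\<pi> \<in> ?P" "t < N" "a \<in> {1..k}" "a \<noteq> b" for \<pi> t a
    proof -
      have "psubst (\<lambda>v. pvar (\<pi> v)) (f t a) = psubst pvar (f t a)"
        by (rule psubst_cong[OF f_polys[OF that(2,3)]])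
           (use that in \<open>auto simp: permutes_not_in\<close>)
      then show ?thesis by (simp add: psubst_pvar)
    qed
    have "h = pconst c * (\<Sum>\<pi>\<in>?P. psubst (\<lambda>v. pvar (\<pi> v)) h)"
      unfolding c_def by (rule sum_permutations_eq) (use sym[OF b] in auto)
    also have "\<dots> = (\<Sum>t<N. \<Sum>\<pi>\<in>?P. pconst c * (\<Prod>a=1..k. psubst (\<lambda>v. pvar (\<pi> v)) (f t a)))"
      unfolding f(1) by (simp add: sum_distrib_left) (rule sum.swap)
    also have "\<dots> = (\<Sum>t<N. \<Prod>a=1..k. f' t a)"
    proof (rule sum.cong[OF refl])
      fix t assume t: "t \<in> {..<N}"
      have "(\<Sum>\<pi>\<in>?P. pconst c * (\<Prod>a=1..k. psubst (\<lambda>v. pvar (\<pi> v)) (f t a))) =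
          (\<Sum>\<pi>\<in>?P. pconst c * (psubst (\<lambda>v. pvar (\<pi> v)) (f t b) * (\<Prod>a\<in>{1..k} - {b}. f t a)))"
      proof (rule sum.cong[OF refl])
        fix \<pi> assume "\<pi> \<in> ?P"
        then have "(\<Prod>a\<in>{1..k} - {b}. psubst (\<lambda>v. pvar (\<pi> v)) (f t a)) = (\<Prod>a\<in>{1..k} - {b}. f t a)"
          using t by (intro prod.cong refl other) auto
        then show "pconst c * (\<Prod>a=1..k. psubst (\<lambda>v. pvar (\<pi> v)) (f t a)) =
          pconst c * (psubst (\<lambda>v. pvar (\<pi> v)) (f t b) * (\<Prod>a\<in>{1..k} - {b}. f t a))"
          using b by (simp only: prod.remove[OF finite_atLeastAtMost b])
      qed
      also have "\<dots> = f' t b * (\<Prod>a\<in>{1..k} - {b}. f t a)"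
        by (simp add: f'_def sum_distrib_left sum_distrib_right mult.assoc)
      also have "(\<Prod>a\<in>{1..k} - {b}. f t a) = (\<Prod>a\<in>{1..k} - {b}. f' t a)"
        by (rule prod.cong) (auto simp: f'_def)
      also have "f' t b * \<dots> = (\<Prod>a=1..k. f' t a)"
        by (simp only: prod.remove[OF finite_atLeastAtMost b])
      finally show "(\<Sum>\<pi>\<in>?P. pconst c * (\<Prod>a=1..k. psubst (\<lambda>v. pvar (\<pi> v)) (f t a))) =
          (\<Prod>a=1..k. f' t a)" .
    qed
    moreover have "f' t a \<in> (if a \<in> insert b A then sym_polys (?B a) else polys (?B a))"
      if "t < N" "a \<in> {1..k}" for t a
      using f(2)[OF that] f_polys[OF that]
      by (auto simp: f'_def intro!: sym_polys_smult sum_permutations_sym)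
    ultimately show ?case by blast
  qed
  from this[of "{1..k}"] show ?thesis
    unfolding S_ring_def by auto
qed

text \<open>The image of \<open>f\<close> and the generator are both block symmetric and use only
  variables of the index set. Cancelling the nonzero generator passes both properties to the
  quotient.\<close>

lemma phi_in_ideal:
  assumes k: "k \<ge> 1" and rp: "restricted_partition k n lam" and f: "f \<in> Gamma_space k b0 n lam"
  shows "\<exists>h\<in>S_ring k lam. phi k lam f = G_poly k b0 lam * h"
proof -
  let ?V = "index_set k lam" and ?G = "G_poly k b0 lam"
  have fs: "f \<in> sym_polys {1..n}" "f \<in> polys {1..n}"
    using f unfolding Gamma_space_def F_space_def sym_polys_def by blast+
  obtain h where h: "phi k lam f = ?G * h"
    using G_poly_dvd_phi[OF rp f] by (auto simp: dvd_def)
  have "h \<in> polys ?V"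
  proof -
    \<comment> \<open>Setting all foreign variables to zero fixes the image and the generator, hence
      also \<open>h\<close>.\<close>
    let ?s = "\<lambda>v. if v \<in> ?V then pvar v else (0 :: (nat \<times> nat) cpoly)"
    have id: "psubst ?s p = p" if "p \<in> polys ?V" for p
    proof -
      have "psubst ?s p = psubst pvar p" by (rule psubst_cong[OF that]) auto
      then show ?thesis by (simp add: psubst_pvar)
    qed
    have "?G * psubst ?s h = psubst ?s (phi k lam f)"
      by (simp add: h id[OF polys_G_poly])
    also have "\<dots> = ?G * h" unfolding id[OF polys_phi[OF rp fs(2)]] by (rule h)
    finally have "psubst ?s h = h" using G_poly_neq_0 by simp
    moreover have "psubst ?s h \<in> polys ?V"
    proof (rule polys_psubst[where V = UNIV])
      show "h \<in> polys UNIV" by (simp add: polys_def)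
    qed simp
    ultimately show ?thesis by simp
  qed
  moreover have "psubst (\<lambda>v. pvar (\<pi> v)) h = h"
    if a: "a \<in> {1..k}" and \<pi>: "\<pi> permutes {a} \<times> {1..mult_part a lam}" for a \<pi>
  proof -
    have \<pi>V: "\<pi> permutes ?V"
      by (rule permutes_subset[OF \<pi>]) (use a in \<open>auto simp: index_set_def\<close>)
    have fst: "fst (\<pi> u) = fst u" for u
      using permutes_in_image[OF \<pi>, of u] permutes_not_in[OF \<pi>, of u]
      by (cases "u \<in> {a} \<times> {1..mult_part a lam}") (auto simp: mem_Times_iff)
    have inv: "psubst (\<lambda>v. pvar (\<pi> v)) p = p" if "block_sym ?V p" for p
      by (rule peval_eqI) (simp add: block_symD[OF that \<pi>V fst])
    have "?G * psubst (\<lambda>v. pvar (\<pi> v)) h = psubst (\<lambda>v. pvar (\<pi> v)) (phi k lam f)"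
      by (simp add: h inv[OF block_sym_G_poly])
    also have "\<dots> = ?G * h"
      unfolding inv[OF block_sym_phi[OF rp fs(1)]] by (rule h)
    finally show ?thesis using G_poly_neq_0 by simp
  qed
  ultimately have "h \<in> S_ring k lam" by (intro S_ringI[OF k])
  with h show ?thesis by blast
qed

section \<open>Power sums generate the symmetric polynomials\<close>

definition subalgebra :: "'v cpoly set \<Rightarrow> bool"
  where "subalgebra R \<longleftrightarrow> (\<forall>z. pconst z \<in> R) \<and> (\<forall>p\<in>R. \<forall>q\<in>R. p + q \<in> R \<and> p * q \<in> R)"

lemma subalgebra_pconst: "subalgebra R \<Longrightarrow> pconst z \<in> R"
  and subalgebra_add: "subalgebra R \<Longrightarrow> p \<in> R \<Longrightarrow> q \<in> R \<Longrightarrow> p + q \<in> R"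
  and subalgebra_mult: "subalgebra R \<Longrightarrow> p \<in> R \<Longrightarrow> q \<in> R \<Longrightarrow> p * q \<in> R"
  by (auto simp: subalgebra_def)

lemma subalgebra_sum: "subalgebra R \<Longrightarrow> (\<And>i. i \<in> A \<Longrightarrow> f i \<in> R) \<Longrightarrow> sum f A \<in> R"
  using subalgebra_pconst[of R 0]
  by (induction A rule: infinite_finite_induct) (auto intro: subalgebra_add)

lemma subalgebra_prod: "subalgebra R \<Longrightarrow> (\<And>i. i \<in> A \<Longrightarrow> f i \<in> R) \<Longrightarrow> prod f A \<in> R"
  using subalgebra_pconst[of R 1]
  by (induction A rule: infinite_finite_induct) (auto intro: subalgebra_mult)

lemma subalgebra_diff:
  assumes "subalgebra R" "p \<in> R" "q \<in> R"
  shows "p - q \<in> R"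
proof -
  have eq: "p - q = p + pconst (-1) * q" by (rule peval_eqI) simp
  show ?thesis
    unfolding eq by (intro subalgebra_add subalgebra_mult subalgebra_pconst assms)
qed

lemma of_nat_pconst: "of_nat m = pconst (of_nat m)"
  by (induction m) (simp_all add: pconst_add)

text \<open>In the induction step the product of a power sum with the sum for \<open>B\<close> is
  \<open>card (W - B)\<close> times the sum for \<open>insert b B\<close>, plus sums for \<open>B\<close> with one exponent increased.\<close>

lemma sum_permutations_monomial_mem:
  assumes W: "finite W" and R: "subalgebra R" and pow: "\<And>r. (\<Sum>w\<in>W. pvar w ^ r) \<in> R"
    and "finite B" "B \<subseteq> W"
  shows "(\<Sum>\<pi> | \<pi> permutes W. \<Prod>b\<in>B. pvar (\<pi> b) ^ e b) \<in> R"
  using assms(4,5)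
proof (induction B arbitrary: e)
  case empty
  show ?case by (simp add: of_nat_pconst subalgebra_pconst[OF R])
next
  case (insert b B)
  let ?P = "{\<pi>. \<pi> permutes W}"
  define T where "T C e = (\<Sum>\<pi>\<in>?P. \<Prod>c\<in>C. pvar (\<pi> c) ^ e c)" for C and e :: "'a \<Rightarrow> nat"
  define S where "S w = (\<Sum>\<pi>\<in>?P. pvar (\<pi> w) ^ e b * (\<Prod>c\<in>B. pvar (\<pi> c) ^ e c))" for w
  have sub: "B \<subseteq> W" "b \<in> W" "finite B" "b \<notin> B" using insert by auto
  have TB: "T B e' \<in> R" for e' unfolding T_def using insert.IH sub(1) by blast
  have S_b: "S b = T (insert b B) e" using sub by (simp add: S_def T_def)
  have S_in: "S w = T B (e(w := e w + e b))" if "w \<in> B" for w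
    unfolding S_def T_def
  proof (rule sum.cong[OF refl])
    fix \<pi>
    have "(\<Prod>c\<in>B. pvar (\<pi> c) ^ (e(w := e w + e b)) c) =
        pvar (\<pi> w) ^ (e w + e b) * (\<Prod>c\<in>B - {w}. pvar (\<pi> c) ^ e c)"
      using that sub by (simp add: prod.remove[of B w])
    then show "pvar (\<pi> w) ^ e b * (\<Prod>c\<in>B. pvar (\<pi> c) ^ e c) =
        (\<Prod>c\<in>B. pvar (\<pi> c) ^ (e(w := e w + e b)) c)"
      using that sub by (simp add: prod.remove[of B w] power_add mult_ac)
  qed
  \<comment> \<open>The transposition of \<open>w\<close> and \<open>b\<close> fixes
    \<open>B\<close> pointwise, so all positions outside \<open>B\<close> contribute alike.\<close>
  have S_out: "S w = S b" if "w \<in> W - B" for w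
  proof -
    let ?\<tau> = "Transposition.transpose w b"
    have \<tau>: "?\<tau> permutes W" using that sub by (intro permutes_swap_id) auto
    have "S w = (\<Sum>\<pi>\<in>?P. pvar ((\<pi> \<circ> ?\<tau>) w) ^ e b * (\<Prod>c\<in>B. pvar ((\<pi> \<circ> ?\<tau>) c) ^ e c))"
      unfolding S_def by (rule sum_permutations_compose_right[OF \<tau>])
    also have "\<dots> = S b"
      unfolding S_def
    proof (intro sum.cong refl arg_cong2[where f="(*)"] prod.cong)
      fix \<pi> c assume "c \<in> B"
      then have "c \<noteq> w" "c \<noteq> b" using that sub by auto
      then show "pvar ((\<pi> \<circ> ?\<tau>) c) ^ e c = pvar (\<pi> c) ^ e c" by simp
    qed simp
    finally show ?thesis .
  qed
  have "(\<Sum>w\<in>W. pvar w ^ e b) * T B e = (\<Sum>\<pi>\<in>?P. (\<Sum>w\<in>W. pvar (\<pi> w) ^ e b) * (\<Prod>c\<in>B. pvar (\<pi> c) ^ e c))"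
    unfolding T_def sum_distrib_left
  proof (rule sum.cong[OF refl])
    fix \<pi> assume "\<pi> \<in> ?P"
    then have "(\<Sum>w\<in>W. pvar w ^ e b) = (\<Sum>w\<in>W. pvar (\<pi> w) ^ e b)"
      using sum.permute[of \<pi> W "\<lambda>w. pvar w ^ e b"] by (simp add: comp_def)
    then show "(\<Sum>w\<in>W. pvar w ^ e b) * (\<Prod>c\<in>B. pvar (\<pi> c) ^ e c) =
        (\<Sum>w\<in>W. pvar (\<pi> w) ^ e b) * (\<Prod>c\<in>B. pvar (\<pi> c) ^ e c)" by simp
  qed
  also have "\<dots> = (\<Sum>w\<in>W. S w)"
    unfolding S_def sum_distrib_right by (rule sum.swap)
  also have "\<dots> = (\<Sum>w\<in>B. S w) + (\<Sum>w\<in>W - B. S w)"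
    using W sub(1) by (metis add.commute sum.subset_diff)
  also have "(\<Sum>w\<in>B. S w) = (\<Sum>w\<in>B. T B (e(w := e w + e b)))"
    by (rule sum.cong) (auto simp: S_in)
  also have "(\<Sum>w\<in>W - B. S w) = (\<Sum>w\<in>W - B. T (insert b B) e)"
    by (rule sum.cong[OF refl]) (use S_out S_b in simp)
  also have "\<dots> = pconst (of_nat (card (W - B))) * T (insert b B) e"
    by (simp add: of_nat_pconst)
  finally have eq: "(\<Sum>w\<in>W. pvar w ^ e b) * T B e =
      (\<Sum>w\<in>B. T B (e(w := e w + e b))) + pconst (of_nat (card (W - B))) * T (insert b B) e" .
  have "card (W - B) \<noteq> 0" using sub W by auto
  then have "pconst (1 / of_nat (card (W - B))) * pconst (of_nat (card (W - B))) = (1 :: 'a cpoly)"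
    by (simp flip: pconst_mult)
  then have "T (insert b B) e = pconst (1 / of_nat (card (W - B))) *
      (pconst (of_nat (card (W - B))) * T (insert b B) e)"
    by (simp add: mult.assoc[symmetric])
  also have "pconst (of_nat (card (W - B))) * T (insert b B) e =
      (\<Sum>w\<in>W. pvar w ^ e b) * T B e - (\<Sum>w\<in>B. T B (e(w := e w + e b)))"
    using eq by simp
  finally have "T (insert b B) e = pconst (1 / of_nat (card (W - B))) *
      ((\<Sum>w\<in>W. pvar w ^ e b) * T B e - (\<Sum>w\<in>B. T B (e(w := e w + e b))))" .
  moreover have "\<dots> \<in> R"
    by (intro subalgebra_mult[OF R] subalgebra_diff[OF R] subalgebra_sum[OF R] subalgebra_pconst[OF R] TB pow)
  ultimately show ?case by (simp add: T_def)
qed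

text \<open>A symmetric polynomial is the average of its permuted copies. Taken monomial by
  monomial, this is a linear combination of the sums in the previous lemma.\<close>

lemma sym_polys_subset_subalgebra:
  assumes W: "finite W" and R: "subalgebra R" and pow: "\<And>r. (\<Sum>w\<in>W. pvar w ^ r) \<in> R"
  shows "sym_polys W \<subseteq> R"
proof
  fix p assume p: "p \<in> sym_polys W"
  then have p_polys: "p \<in> polys W" by (simp add: sym_polys_def)
  have "p = pconst (1 / fact (card W)) * (\<Sum>\<pi> | \<pi> permutes W. psubst (\<lambda>v. pvar (\<pi> v)) p)"
    by (rule sum_permutations_eq[OF W]) (use p in \<open>auto simp: sym_polys_def\<close>)
  also have "(\<Sum>\<pi> | \<pi> permutes W. psubst (\<lambda>v. pvar (\<pi> v)) p) =
      (\<Sum>\<pi> | \<pi> permutes W. \<Sum>m\<in>keys p. pconst (lookup p m) * (\<Prod>w\<in>W. pvar (\<pi> w) ^ lookup m w))"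
  proof (rule sum.cong[OF refl])
    fix \<pi>
    have "psubst (\<lambda>v. pvar (\<pi> v)) p = (\<Sum>m\<in>keys p. pconst (lookup p m) * mon_eval (\<lambda>v. pvar (\<pi> v)) m)"
      by (simp add: psubst_def insertion_def mon_eval_def)
    also have "\<dots> = (\<Sum>m\<in>keys p. pconst (lookup p m) * (\<Prod>w\<in>W. pvar (\<pi> w) ^ lookup m w))"
      by (intro sum.cong refl arg_cong2[where f="(*)"] mon_eval_superset[OF W])
         (use p_polys in \<open>auto simp: polys_def\<close>)
    finally show "psubst (\<lambda>v. pvar (\<pi> v)) p =
        (\<Sum>m\<in>keys p. pconst (lookup p m) * (\<Prod>w\<in>W. pvar (\<pi> w) ^ lookup m w))" .
  qed
  also have "\<dots> = (\<Sum>m\<in>keys p. pconst (lookup p m) *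
      (\<Sum>\<pi> | \<pi> permutes W. \<Prod>w\<in>W. pvar (\<pi> w) ^ lookup m w))"
    unfolding sum_distrib_left by (rule sum.swap)
  finally have "p = pconst (1 / fact (card W)) * (\<Sum>m\<in>keys p. pconst (lookup p m) *
      (\<Sum>\<pi> | \<pi> permutes W. \<Prod>w\<in>W. pvar (\<pi> w) ^ lookup m w))" .
  moreover have "\<dots> \<in> R"
    by (intro subalgebra_mult[OF R] subalgebra_sum[OF R] subalgebra_pconst[OF R]
        sum_permutations_monomial_mem[OF W R pow W order_refl])
  ultimately show "p \<in> R" by simp
qed

section \<open>Surjectivity\<close>

text \<open>A 0-1 matrix whose column sums are conjugate to its row sums is the Ferrers diagram. By
  induction on columns, a row with \<open>s u < j\<close> has spent all its entries before column
  \<open>j\<close>; so column \<open>j\<close> lies inside the diagram, and its size forces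
  equality.\<close>

lemma zero_one_matrix_unique:
  assumes Y: "finite Y" "Y \<subseteq> V \<times> {1..}" and V: "finite V"
    and row: "\<And>u. u \<in> V \<Longrightarrow> card {j. (u, j) \<in> Y} = s u"
    and col: "\<And>j. j \<ge> 1 \<Longrightarrow> card {u. (u, j) \<in> Y} = card {u \<in> V. j \<le> s u}"
  shows "Y = (SIGMA u:V. {1..s u :: nat})"
proof -
  have fin: "finite {j. (u, j) \<in> Y}" for u
    by (rule finite_subset[of _ "snd ` Y"]) (use Y in force)+
  have "{u. (u, j) \<in> Y} = {u \<in> V. j \<le> s u}" if "j \<ge> 1" for j
    using that
  proof (induction j rule: less_induct)
    case (less j)
    have "{u. (u, j) \<in> Y} \<subseteq> {u \<in> V. j \<le> s u}"
    proof
      fix u assume "u \<in> {u. (u, j) \<in> Y}"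
      then have u: "(u, j) \<in> Y" "u \<in> V" using Y by auto
      have "j \<le> s u"
      proof (rule ccontr)
        assume "\<not> j \<le> s u"
        have "i \<in> {j. (u, j) \<in> Y}" if "i \<in> {1..s u}" for i
        proof -
          have "u \<in> {u. (u, i) \<in> Y}"
            using less.IH[of i] that \<open>\<not> j \<le> s u\<close> u(2) by auto
          then show ?thesis by simp
        qed
        with u have "insert j {1..s u} \<subseteq> {j. (u, j) \<in> Y}" by auto
        from card_mono[OF fin this] \<open>\<not> j \<le> s u\<close> row[OF u(2)] show False by simp
      qed
      with u show "u \<in> {u \<in> V. j \<le> s u}" by simp
    qed
    then show ?case
      by (rule card_subset_eq[rotated]) (use V col less.prems in auto)
  qed
  then have "(u, j) \<in> Y \<longleftrightarrow> u \<in> V \<and> j \<le> s u" if "j \<ge> 1" for u j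
    using that by blast
  then show ?thesis using Y(2) by auto
qed

lemma permutes_card_comp:
  assumes "\<sigma> permutes S"
  shows "card {p \<in> S. P (\<sigma> p)} = card {p \<in> S. P p}"
proof -
  have "{p \<in> S. P p} = {p \<in> \<sigma> ` S. P p}"
    by (simp add: permutes_image[OF assms])
  also have "\<dots> = \<sigma> ` {p \<in> S. P (\<sigma> p)}" by auto
  finally show ?thesis
    by (simp add: card_image[OF permutes_inj_on[OF assms]])
qed

section \<open>Cells and columns of the Young diagram\<close>

lemma ex_columns:
  assumes rp: "restricted_partition k n lam"
  obtains col where "\<And>u. u \<in> index_set k lam \<Longrightarrow>
    bij_betw col {p \<in> {1..n}. group_of k lam p = u} {1..fst u}"
proof -
  have "\<exists>c. bij_betw c {p \<in> {1..n}. group_of k lam p = u} {1..fst u}" if "u \<in> index_set k lam" for u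
    by (rule finite_same_card_bij) (simp_all add: card_group[OF rp that, simplified])
  then obtain c where c: "\<And>u. u \<in> index_set k lam \<Longrightarrow>
      bij_betw (c u) {p \<in> {1..n}. group_of k lam p = u} {1..fst u}"
    by metis
  show ?thesis
  proof (rule that[of "\<lambda>p. c (group_of k lam p) p"])
    fix u assume "u \<in> index_set k lam"
    from c[OF this] show "bij_betw (\<lambda>p. c (group_of k lam p) p)
        {p \<in> {1..n}. group_of k lam p = u} {1..fst u}"
      by (subst bij_betw_cong[of _ _ "c u"]) auto
  qed
qed

context
  fixes k b0 n :: nat and lam :: "nat list" and col :: "nat \<Rightarrow> nat"
  assumes rp: "restricted_partition k n lam"
    and col: "\<And>u. u \<in> index_set k lam \<Longrightarrow>
      bij_betw col {p \<in> {1..n}. group_of k lam p = u} {1..fst u}"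
begin

private abbreviation "U \<equiv> index_set k lam"
private abbreviation "gr \<equiv> group_of k lam"
private abbreviation "cells \<equiv> (SIGMA u:U. {1..fst u})"

private lemma col_range: "p \<in> {1..n} \<Longrightarrow> 1 \<le> col p \<and> col p \<le> fst (gr p)"
  using col[OF group_of_in[OF rp], of p] unfolding bij_betw_def by fastforce

private lemma col_le: "p \<in> {1..n} \<Longrightarrow> col p \<le> k"
  using col_range[of p] fst_index_set[OF group_of_in[OF rp, of p]] by linarith

private lemma cell_bij: "bij_betw (\<lambda>p. (gr p, col p)) {1..n} cells"
  unfolding bij_betw_def
proof
  show "inj_on (\<lambda>p. (gr p, col p)) {1..n}"
  proof (rule inj_onI)
    fix p q assume pq: "p \<in> {1..n}" "q \<in> {1..n}" "(gr p, col p) = (gr q, col q)"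
    have "inj_on col {r \<in> {1..n}. gr r = gr p}"
      using col[OF group_of_in[OF rp pq(1)]] by (simp add: bij_betw_def)
    from inj_onD[OF this, of p q] pq show "p = q" by simp
  qed
  show "(\<lambda>p. (gr p, col p)) ` {1..n} = cells"
  proof
    show "(\<lambda>p. (gr p, col p)) ` {1..n} \<subseteq> cells"
      using group_of_in[OF rp] col_range by auto
    show "cells \<subseteq> (\<lambda>p. (gr p, col p)) ` {1..n}"
    proof
      fix c assume "c \<in> cells"
      then obtain u j where c: "c = (u, j)" "u \<in> U" "j \<in> {1..fst u}" by auto
      with col[OF c(2)] have "j \<in> col ` {p \<in> {1..n}. gr p = u}" by (simp add: bij_betw_def)
      with c show "c \<in> (\<lambda>p. (gr p, col p)) ` {1..n}" by auto
    qed
  qed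
qed

text \<open>Each group of size at least \<open>j\<close> has exactly one cell in column
  \<open>j\<close>, so the column lengths form the conjugate partition.\<close>

private lemma card_column: "j \<ge> 1 \<Longrightarrow> card {p \<in> {1..n}. col p = j} = card {u \<in> U. j \<le> fst u}"
proof -
  assume j: "j \<ge> 1"
  have "bij_betw gr {p \<in> {1..n}. col p = j} {u \<in> U. j \<le> fst u}"
    unfolding bij_betw_def
  proof
    show "inj_on gr {p \<in> {1..n}. col p = j}"
    proof (rule inj_onI)
      fix p q assume "p \<in> {p \<in> {1..n}. col p = j}" "q \<in> {p \<in> {1..n}. col p = j}" "gr p = gr q"
      then show "p = q"
        by (intro inj_onD[OF bij_betw_imp_inj_on[OF cell_bij], of p q]) auto
    qed
    show "gr ` {p \<in> {1..n}. col p = j} = {u \<in> U. j \<le> fst u}"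
    proof
      show "gr ` {p \<in> {1..n}. col p = j} \<subseteq> {u \<in> U. j \<le> fst u}"
        using group_of_in[OF rp] col_range by auto
      show "{u \<in> U. j \<le> fst u} \<subseteq> gr ` {p \<in> {1..n}. col p = j}"
      proof
        fix u assume "u \<in> {u \<in> U. j \<le> fst u}"
        with j have "(u, j) \<in> (\<lambda>p. (gr p, col p)) ` {1..n}"
          using cell_bij by (simp add: bij_betw_def)
        then show "u \<in> gr ` {p \<in> {1..n}. col p = j}" by auto
      qed
    qed
  qed
  then show ?thesis by (rule bij_betw_same_card)
qed

section \<open>Column symmetry and the squared Vandermonde products\<close>

private definition col_perm :: "(nat \<Rightarrow> nat) \<Rightarrow> bool"
  where "col_perm \<pi> \<longleftrightarrow> \<pi> permutes {1..n} \<and> (\<forall>p\<in>{1..n}. col (\<pi> p) = col p)"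

private definition col_sym :: "nat cpoly set"
  where "col_sym = {h \<in> polys {1..n}. \<forall>\<pi> x. col_perm \<pi> \<longrightarrow> peval (\<lambda>p. x (\<pi> p)) h = peval x h}"

private lemma col_symD: "h \<in> col_sym \<Longrightarrow> col_perm \<pi> \<Longrightarrow> peval (\<lambda>p. x (\<pi> p)) h = peval x h"
  unfolding col_sym_def by blast

private definition disc :: "nat cpoly"
  where "disc = (\<Prod>(p, q)\<in>{(p, q) \<in> {1..n} \<times> {1..n}. p < q}.
      if col p = col q then (pvar p - pvar q)\<^sup>2 else 1) *
    (\<Prod>p\<in>{1..n}. if b0 < col p then pvar p else 1)"

private lemma peval_if: "peval x (if b then p else q) = (if b then peval x p else peval x q)"
  by simp

private lemma peval_disc:
  "peval x disc = (\<Prod>(p, q)\<in>{(p, q) \<in> {1..n} \<times> {1..n}. p < q}.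
      if col p = col q then (x p - x q)\<^sup>2 else 1) *
    (\<Prod>p\<in>{1..n}. if b0 < col p then x p else 1)"
  by (simp add: disc_def case_prod_beta peval_if cong: if_cong)

private lemma disc_col_sym: "disc \<in> col_sym"
  unfolding col_sym_def
proof (intro CollectI conjI allI impI)
  show "disc \<in> polys {1..n}"
    unfolding disc_def by (auto intro!: polys_mult polys_prod polys_power polys_diff)
  fix \<pi> and x :: "nat \<Rightarrow> complex" assume "col_perm \<pi>"
  then have \<pi>: "\<pi> permutes {1..n}" and c: "\<And>p. p \<in> {1..n} \<Longrightarrow> col (\<pi> p) = col p"
    by (auto simp: col_perm_def)
  define q where "q p p' = (if col p = col p' then (x p - x p')\<^sup>2 else 1)" for p p'
  have "(\<Prod>(p, p')\<in>{(p, p') \<in> {1..n} \<times> {1..n}. p < p'}.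
        if col p = col p' then (x (\<pi> p) - x (\<pi> p'))\<^sup>2 else 1) =
      (\<Prod>(p, p')\<in>{(p, p') \<in> {1..n} \<times> {1..n}. p < p'}. q (\<pi> p) (\<pi> p'))"
    by (rule prod.cong) (auto simp: q_def c)
  also have "\<dots> = (\<Prod>(p, p')\<in>{(p, p') \<in> {1..n} \<times> {1..n}. p < p'}. q p p')"
    by (rule prod_ordered_pairs_permute[OF \<pi>]) (auto simp: q_def power2_commute)
  finally have 1: "(\<Prod>(p, p')\<in>{(p, p') \<in> {1..n} \<times> {1..n}. p < p'}.
        if col p = col p' then (x (\<pi> p) - x (\<pi> p'))\<^sup>2 else 1) =
      (\<Prod>(p, p')\<in>{(p, p') \<in> {1..n} \<times> {1..n}. p < p'}. q p p')" .
  have "(\<Prod>p\<in>{1..n}. if b0 < col p then x (\<pi> p) else 1) =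
      (\<Prod>p\<in>{1..n}. if b0 < col (\<pi> p) then x (\<pi> p) else 1)"
    by (rule prod.cong) (auto simp: c)
  also have "\<dots> = (\<Prod>p\<in>{1..n}. if b0 < col p then x p else 1)"
    using prod.permute[OF \<pi>, of "\<lambda>p. if b0 < col p then x p else 1"] by (simp add: comp_def)
  finally show "peval (\<lambda>p. x (\<pi> p)) disc = peval x disc"
    by (simp only: peval_disc 1 q_def)
qed

private lemma disc_nonzero_inj:
  assumes "peval x disc \<noteq> 0" "p \<in> {1..n}" "q \<in> {1..n}" "p \<noteq> q" "col p = col q"
  shows "x p \<noteq> x q"
proof -
  have fin: "finite {(p, q) \<in> {1..n} \<times> {1..n}. p < q}"
    by (rule finite_subset[of _ "{1..n} \<times> {1..n}"]) auto
  have *: "x p \<noteq> x q" if "p \<in> {1..n}" "q \<in> {1..n}" "p < q" "col p = col q" for p q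
  proof
    assume "x p = x q"
    with that have "(\<Prod>(p, q)\<in>{(p, q) \<in> {1..n} \<times> {1..n}. p < q}.
        if col p = col q then (x p - x q)\<^sup>2 else 1) = 0"
      by (intro prod_zero[OF fin] bexI[of _ "(p, q)"]) auto
    with assms(1) show False by (simp add: peval_disc)
  qed
  show ?thesis using *[of p q] *[of q p] assms by (cases "p < q") auto
qed

private lemma disc_nonzero_var:
  assumes "peval x disc \<noteq> 0" "p \<in> {1..n}" "b0 < col p"
  shows "x p \<noteq> 0"
proof
  assume "x p = 0"
  with assms(2,3) have "(\<Prod>p\<in>{1..n}. if b0 < col p then x p else 1) = 0"
    by (intro prod_zero) (auto intro!: bexI[of _ p])
  with assms(1) show False by (simp add: peval_disc)
qed

text \<open>Nonvanishing forces distinct values within each column, and there are only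
  \<open>k\<close> columns. In the next lemma the columns beyond \<open>b0\<close> admit no zero
  either, which leaves \<open>b0\<close> columns.\<close>

private lemma disc_zero_eq:
  assumes "B \<subseteq> {1..n}" "k < card B" "\<And>p. p \<in> B \<Longrightarrow> x p = c"
  shows "peval x disc = 0"
proof (rule ccontr)
  assume nz: "peval x disc \<noteq> 0"
  have "inj_on col B"
    by (rule inj_onI) (use disc_nonzero_inj[OF nz] assms in \<open>metis subsetD\<close>)
  moreover have "col ` B \<subseteq> {1..k}" using assms(1) col_range col_le by auto
  ultimately have "card B \<le> card {1..k}" by (rule card_inj_on_le) simp
  with assms(2) show False by simp
qed

private lemma disc_zero_0:
  assumes "B \<subseteq> {1..n}" "b0 < card B" "\<And>p. p \<in> B \<Longrightarrow> x p = 0"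
  shows "peval x disc = 0"
proof (rule ccontr)
  assume nz: "peval x disc \<noteq> 0"
  have "inj_on col B"
    by (rule inj_onI) (use disc_nonzero_inj[OF nz] assms in \<open>metis subsetD\<close>)
  moreover have "col ` B \<subseteq> {1..b0}"
    using assms(1) col_range disc_nonzero_var[OF nz] assms(3) by (auto simp: not_le[symmetric] subset_iff)
  ultimately have "card B \<le> card {1..b0}" by (rule card_inj_on_le) simp
  with assms(2) show False by simp
qed

section \<open>Symmetrisation and membership in the Gamma space\<close>

private definition symmetrization :: "nat cpoly \<Rightarrow> nat cpoly"
  where "symmetrization h = (\<Sum>\<sigma> | \<sigma> permutes {1..n}. psubst (\<lambda>p. pvar (\<sigma> p)) (disc * h))"

private lemma peval_symmetrization:
  "peval x (symmetrization h) =
    (\<Sum>\<sigma> | \<sigma> permutes {1..n}. peval (\<lambda>p. x (\<sigma> p)) disc * peval (\<lambda>p. x (\<sigma> p)) h)"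
  by (simp add: symmetrization_def)

private lemma symmetrization_F_space:
  assumes h: "h \<in> col_sym"
  shows "symmetrization h \<in> F_space k b0 n"
proof -
  have "symmetrization h \<in> sym_polys {1..n}"
    unfolding symmetrization_def
    by (rule sum_permutations_sym) (use h disc_col_sym in \<open>auto simp: col_sym_def\<close>)
  \<comment> \<open>These are the positions that \<open>\<sigma>\<close> sends to the first
    \<open>m\<close> variables; in the summand of \<open>\<sigma>\<close> they carry the equal or
    zero coordinates.\<close>
  moreover have B: "inv \<sigma> ` {1..m} \<subseteq> {1..n} \<and> card (inv \<sigma> ` {1..m}) = m"
    if "\<sigma> permutes {1..n}" "m \<le> n" for \<sigma> m
  proof -
    have \<sigma>: "inv \<sigma> permutes {1..n}" using permutes_inv that(1) by blast
    have "inv \<sigma> ` {1..m} \<subseteq> inv \<sigma> ` {1..n}" using that by auto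
    then show ?thesis
      using permutes_image[OF \<sigma>] card_image[of "inv \<sigma>" "{1..m}"] permutes_inj_on[OF \<sigma>] by auto
  qed
  have "peval x (symmetrization h) = 0" if "k + 1 \<le> n" "\<forall>i\<in>{1..k + 1}. x i = x 1" for x
    unfolding peval_symmetrization
  proof (rule sum.neutral, rule ballI)
    fix \<sigma> assume "\<sigma> \<in> {\<sigma>. \<sigma> permutes {1..n}}"
    then have \<sigma>: "\<sigma> permutes {1..n}" by simp
    have "peval (\<lambda>p. x (\<sigma> p)) disc = 0"
    proof (rule disc_zero_eq[of "inv \<sigma> ` {1..k + 1}" _ "x 1"])
      fix p assume "p \<in> inv \<sigma> ` {1..k + 1}"
      then obtain i where "p = inv \<sigma> i" "i \<in> {1..k + 1}" by blast
      then show "x (\<sigma> p) = x 1" using that(2) permutes_inverses(1)[OF \<sigma>] by metis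
    qed (use B[OF \<sigma> that(1)] in auto)
    then show "peval (\<lambda>p. x (\<sigma> p)) disc * peval (\<lambda>p. x (\<sigma> p)) h = 0" by simp
  qed
  moreover have "peval x (symmetrization h) = 0" if "b0 + 1 \<le> n" "\<forall>i\<in>{1..b0 + 1}. x i = 0" for x
    unfolding peval_symmetrization
  proof (rule sum.neutral, rule ballI)
    fix \<sigma> assume "\<sigma> \<in> {\<sigma>. \<sigma> permutes {1..n}}"
    then have \<sigma>: "\<sigma> permutes {1..n}" by simp
    have "peval (\<lambda>p. x (\<sigma> p)) disc = 0"
    proof (rule disc_zero_0[of "inv \<sigma> ` {1..b0 + 1}"])
      fix p assume "p \<in> inv \<sigma> ` {1..b0 + 1}"
      then obtain i where "p = inv \<sigma> i" "i \<in> {1..b0 + 1}" by blast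
      then show "x (\<sigma> p) = 0" using that(2) permutes_inverses(1)[OF \<sigma>] by metis
    qed (use B[OF \<sigma> that(1)] in auto)
    then show "peval (\<lambda>p. x (\<sigma> p)) disc * peval (\<lambda>p. x (\<sigma> p)) h = 0" by simp
  qed
  ultimately show ?thesis unfolding F_space_def by blast
qed

text \<open>Rows are sorted, so the set \<open>L j\<close> of rows reaching column \<open>j\<close>
  is an initial segment, and cutting it to the first \<open>m\<close> rows leaves the minimum of the
  two sizes. Counting the cells left by rows instead of columns bounds their number by the partial
  sum of \<open>lam\<close>.\<close>

private lemma sum_min_columns_le:
  "(\<Sum>j=1..k. min m (card {u \<in> U. j \<le> fst u})) \<le> (\<Sum>i<m. part lam i)"
proof -
  obtain ls where ls: "distinct ls" "set ls = U" "map fst ls = lam"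
    using ex_index_list[OF rp] .
  have len: "length ls = length lam" using ls(3) by (metis length_map)
  have sorted: "lam ! i \<ge> lam ! i'" if "i \<le> i'" "i' < length lam" for i i'
    using rp that unfolding restricted_partition_def
    by (metis le_neq_implies_less order_refl sorted_wrt_nth_less)
  define L where "L j = {i. i < length lam \<and> j \<le> lam ! i}" for j
  have fin: "finite (L j)" for j by (simp add: L_def)
  have card_L: "card {u \<in> U. j \<le> fst u} = card (L j)" for j
  proof -
    have "bij_betw ((!) ls) (L j) {u \<in> U. j \<le> fst u}"
      unfolding bij_betw_def
    proof
      show "inj_on ((!) ls) (L j)"
        using ls(1) len by (auto simp: inj_on_def L_def nth_eq_iff_index_eq)
      have fst_ls: "fst (ls ! i) = lam ! i" if "i < length lam" for i
        using that ls(3) len by (metis nth_map)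
      show "(!) ls ` L j = {u \<in> U. j \<le> fst u}"
      proof
        show "(!) ls ` L j \<subseteq> {u \<in> U. j \<le> fst u}"
          using len fst_ls by (auto simp: L_def simp flip: ls(2))
        show "{u \<in> U. j \<le> fst u} \<subseteq> (!) ls ` L j"
        proof
          fix u assume "u \<in> {u \<in> U. j \<le> fst u}"
          then obtain i where "i < length lam" "u = ls ! i" "j \<le> fst u"
            using len by (auto simp: in_set_conv_nth simp flip: ls(2))
          with fst_ls[of i] show "u \<in> (!) ls ` L j" by (auto simp: L_def)
        qed
      qed
    qed
    then show ?thesis by (simp add: bij_betw_same_card)
  qed
  have "min m (card (L j)) \<le> card (L j \<inter> {..<m})" for j
  proof (cases "{..<m} \<subseteq> L j")
    case True
    then have "L j \<inter> {..<m} = {..<m}" by auto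
    then show ?thesis by simp
  next
    case False
    then obtain i where "i < m" "i \<notin> L j" by auto
    have "L j \<subseteq> {..<m}"
    proof
      fix i' assume i': "i' \<in> L j"
      show "i' \<in> {..<m}"
      proof (rule ccontr)
        assume "i' \<notin> {..<m}"
        with \<open>i < m\<close> i' have "i \<in> L j"
          using sorted[of i i'] by (auto simp: L_def)
        with \<open>i \<notin> L j\<close> show False by simp
      qed
    qed
    then show ?thesis by (simp add: Int_absorb2)
  qed
  then have "(\<Sum>j=1..k. min m (card {u \<in> U. j \<le> fst u})) \<le> (\<Sum>j=1..k. card (L j \<inter> {..<m}))"
    unfolding card_L by (rule sum_mono)
  also have "\<dots> = (\<Sum>j=1..k. \<Sum>i<m. if i \<in> L j then 1 else 0)"
    by (intro sum.cong refl) (simp add: sum.If_cases Int_commute)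
  also have "\<dots> = (\<Sum>i<m. \<Sum>j=1..k. if i \<in> L j then 1 else 0)"
    by (rule sum.swap)
  also have "\<dots> \<le> (\<Sum>i<m. part lam i)"
  proof (rule sum_mono)
    fix i
    have "(\<Sum>j=1..k. if i \<in> L j then 1 else 0) = card ({1..k} \<inter> {j. i \<in> L j})"
      by (simp add: sum.If_cases)
    also have "\<dots> \<le> card {1..part lam i}"
      by (rule card_mono) (auto simp: L_def part_def)
    finally show "(\<Sum>j=1..k. if i \<in> L j then 1 else 0) \<le> part lam i" by simp
  qed
  finally show ?thesis .
qed

text \<open>If the value is nonzero, no group meets a column twice, so the first \<open>m\<close>
  groups of \<open>nu\<close> put into each column at most the smaller of \<open>m\<close> and its
  length. Summing bounds the partial sums of \<open>nu\<close> by those of \<open>lam\<close>, a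
  contradiction at the first part that differs.\<close>

private lemma disc_zero_lex_greater:
  assumes nu: "restricted_partition k n nu" "lex_greater nu lam" and \<sigma>: "\<sigma> permutes {1..n}"
  shows "peval (\<lambda>p. y (group_of k nu (\<sigma> p))) disc = 0"
proof (rule ccontr)
  assume nz: "peval (\<lambda>p. y (group_of k nu (\<sigma> p))) disc \<noteq> 0"
  let ?c = "\<lambda>p. group_of k nu (\<sigma> p)"
  have inj: "?c p \<noteq> ?c q" if "p \<in> {1..n}" "q \<in> {1..n}" "p \<noteq> q" "col p = col q" for p q
    using disc_nonzero_inj[OF nz that] by auto
  obtain j0 where j0: "\<And>j. j < j0 \<Longrightarrow> part nu j = part lam j" "part nu j0 > part lam j0"
    using nu(2) by (auto simp: lex_greater_def)
  \<comment> \<open>Positions count from 0, so \<open>Suc j0\<close> parts include the first one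
    that differs; it is positive, hence lies within the list.\<close>
  let ?m = "Suc j0"
  have m: "?m \<le> length nu" using j0(2) by (auto simp: part_def split: if_splits)
  obtain ls where ls: "distinct ls" "set ls = index_set k nu" "map fst ls = nu"
    using ex_index_list[OF nu(1)] .
  have len: "length ls = length nu" using ls(3) by (metis length_map)
  define A where "A = set (take ?m ls)"
  have A: "A \<subseteq> index_set k nu" "finite A" using ls(2) by (auto simp: A_def dest: in_set_takeD)
  have cardA: "card A = ?m"
    unfolding A_def using ls(1) m len by (subst distinct_card) auto
  define Q where "Q = {p \<in> {1..n}. ?c p \<in> A}"
  have "(\<Sum>i<?m. part nu i) = sum_list (take ?m nu)"
    using m by (simp add: sum_list_sum_nth part_def atLeast0LessThan min_absorb2 del: take_Suc)
  also have "\<dots> = (\<Sum>w\<in>A. fst w)"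
    using ls(1) unfolding A_def ls(3)[symmetric] take_map
    by (simp add: sum_list_distinct_conv_sum_set)
  also have "\<dots> = (\<Sum>w\<in>A. card {p \<in> {1..n}. ?c p = w})"
  proof (rule sum.cong[OF refl])
    fix w assume "w \<in> A"
    then have w: "w \<in> index_set k nu" using A by auto
    show "fst w = card {p \<in> {1..n}. ?c p = w}"
      using card_group[OF nu(1) w] permutes_card_comp[OF \<sigma>, of "\<lambda>p. group_of k nu p = w"] by simp
  qed
  also have "\<dots> = card Q"
  proof -
    have "Q = (\<Union>w\<in>A. {p \<in> {1..n}. ?c p = w})" by (auto simp: Q_def)
    moreover have "card (\<Union>w\<in>A. {p \<in> {1..n}. ?c p = w}) = (\<Sum>w\<in>A. card {p \<in> {1..n}. ?c p = w})"
      by (rule card_UN_disjoint) (use A(2) in auto)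
    ultimately show ?thesis by (simp only:)
  qed
  also have "\<dots> = (\<Sum>j=1..k. card {p \<in> Q. col p = j})"
  proof -
    have "Q = (\<Union>j\<in>{1..k}. {p \<in> Q. col p = j})"
      using col_range col_le by (auto simp: Q_def)
    moreover have "finite Q" by (simp add: Q_def)
    ultimately have "card Q = card (\<Union>j\<in>{1..k}. {p \<in> Q. col p = j})" by simp
    also have "\<dots> = (\<Sum>j=1..k. card {p \<in> Q. col p = j})"
      using \<open>finite Q\<close> by (intro card_UN_disjoint) auto
    finally show ?thesis .
  qed
  also have "\<dots> \<le> (\<Sum>j=1..k. min ?m (card {u \<in> U. j \<le> fst u}))"
  proof (rule sum_mono)
    fix j assume j: "j \<in> {1..k}"
    have "card {p \<in> Q. col p = j} \<le> card A"
    proof (rule card_inj_on_le[of ?c])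
      show "inj_on ?c {p \<in> Q. col p = j}"
      proof (rule inj_onI)
        fix p q assume "p \<in> {p \<in> Q. col p = j}" "q \<in> {p \<in> Q. col p = j}" "?c p = ?c q"
        then show "p = q" using inj[of p q] by (auto simp: Q_def)
      qed
    qed (use A in \<open>auto simp: Q_def\<close>)
    moreover have "card {p \<in> Q. col p = j} \<le> card {p \<in> {1..n}. col p = j}"
      by (rule card_mono) (auto simp: Q_def)
    ultimately show "card {p \<in> Q. col p = j} \<le> min ?m (card {u \<in> U. j \<le> fst u})"
      using j card_column[of j] cardA by simp
  qed
  also have "\<dots> \<le> (\<Sum>i<?m. part lam i)" by (rule sum_min_columns_le)
  finally have "(\<Sum>i<?m. part nu i) \<le> (\<Sum>i<?m. part lam i)" .
  moreover have "(\<Sum>i<j0. part nu i) = (\<Sum>i<j0. part lam i)"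
    by (rule sum.cong) (auto simp: j0(1))
  ultimately show False using j0(2) by simp
qed

private lemma symmetrization_Gamma:
  assumes "h \<in> col_sym"
  shows "symmetrization h \<in> Gamma_space k b0 n lam"
proof -
  have "phi k nu (symmetrization h) = 0"
    if "restricted_partition k n nu" "lex_greater nu lam" for nu
    by (rule peval_eqI)
       (simp add: peval_phi peval_symmetrization disc_zero_lex_greater[OF that])
  with symmetrization_F_space[OF assms] show ?thesis by (auto simp: Gamma_space_def)
qed

text \<open>The pairs of permuted group and column form a 0-1 matrix with the row and column sums of
  the Young diagram, hence fill exactly that diagram. Matching them with the original cells gives a
  permutation that keeps columns and acts on groups as \<open>\<sigma>\<close> does.\<close>

private lemma ex_col_perm:
  assumes \<sigma>: "\<sigma> permutes {1..n}" and inj: "inj_on (\<lambda>p. (gr (\<sigma> p), col p)) {1..n}"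
  obtains \<pi> where "col_perm \<pi>" "\<And>p. p \<in> {1..n} \<Longrightarrow> gr (\<sigma> p) = gr (\<pi> p)"
proof -
  define Y where "Y = (\<lambda>p. (gr (\<sigma> p), col p)) ` {1..n}"
  have mem: "\<sigma> p \<in> {1..n} \<longleftrightarrow> p \<in> {1..n}" for p using permutes_in_image[OF \<sigma>] .
  have "Y = cells"
  proof (rule zero_one_matrix_unique)
    show "finite Y" by (simp add: Y_def)
    show "Y \<subseteq> U \<times> {1..}"
    proof
      fix c assume "c \<in> Y"
      then obtain p where "p \<in> {1..n}" "c = (gr (\<sigma> p), col p)" by (auto simp: Y_def)
      then show "c \<in> U \<times> {1..}" using col_range[of p] group_of_in[OF rp, of "\<sigma> p"] mem[of p] by auto
    qed
    fix u assume u: "u \<in> U"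
    let ?Pu = "{p \<in> {1..n}. gr (\<sigma> p) = u}"
    have "{j. (u, j) \<in> Y} = col ` ?Pu" by (auto simp: Y_def)
    moreover have "inj_on col ?Pu"
    proof (rule inj_onI)
      fix p q assume "p \<in> ?Pu" "q \<in> ?Pu" "col p = col q"
      then show "p = q" by (intro inj_onD[OF inj, of p q]) auto
    qed
    moreover have "card ?Pu = fst u"
      using card_group[OF rp u] permutes_card_comp[OF \<sigma>, of "\<lambda>p. gr p = u"] by simp
    ultimately show "card {j. (u, j) \<in> Y} = fst u" by (simp add: card_image)
  next
    fix j :: nat assume j: "j \<ge> 1"
    have "{u. (u, j) \<in> Y} = (\<lambda>p. gr (\<sigma> p)) ` {p \<in> {1..n}. col p = j}" by (auto simp: Y_def)
    moreover have "inj_on (\<lambda>p. gr (\<sigma> p)) {p \<in> {1..n}. col p = j}"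
    proof (rule inj_onI)
      fix p q assume "p \<in> {p \<in> {1..n}. col p = j}" "q \<in> {p \<in> {1..n}. col p = j}" "gr (\<sigma> p) = gr (\<sigma> q)"
      then show "p = q" by (intro inj_onD[OF inj, of p q]) auto
    qed
    ultimately show "card {u. (u, j) \<in> Y} = card {u \<in> U. j \<le> fst u}"
      using card_column[OF j] by (simp add: card_image)
  qed simp
  then have "image_mset (\<lambda>p. (gr (\<sigma> p), col p)) (mset_set {1..n}) =
      image_mset (\<lambda>p. (gr p, col p)) (mset_set {1..n})"
    using cell_bij inj by (simp add: image_mset_mset_set Y_def bij_betw_def)
  from image_mset_eq_implies_permutes[OF _ this] obtain \<pi>
    where "\<pi> permutes {1..n}" "\<forall>p\<in>{1..n}. (gr (\<sigma> p), col p) = (gr (\<pi> p), col (\<pi> p))"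
    by (metis finite_atLeastAtMost)
  then show ?thesis using that[of \<pi>] by (auto simp: col_perm_def)
qed

text \<open>For \<open>u < v\<close> the two groups share exactly the first \<open>fst u\<close>
  columns, each giving one squared difference, hence the exponent \<open>2 * fst u\<close>. Group
  \<open>u\<close> has \<open>fst u - b0\<close> cells beyond column \<open>b0\<close>, which give
  the power of \<open>y u\<close>.\<close>

private lemma peval_disc_group_of: "peval (\<lambda>p. y (gr p)) disc = peval y (G_poly k b0 lam)"
proof -
  define pos where "pos = inv_into {1..n} (\<lambda>p. (gr p, col p))"
  have pos: "pos (u, j) \<in> {1..n} \<and> gr (pos (u, j)) = u \<and> col (pos (u, j)) = j"
    if "u \<in> U" "1 \<le> j" "j \<le> fst u" for u j
  proof -
    have "(u, j) \<in> (\<lambda>p. (gr p, col p)) ` {1..n}"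
      using that cell_bij by (simp add: bij_betw_def)
    from inv_into_into[OF this] f_inv_into_f[OF this] show ?thesis by (simp add: pos_def)
  qed
  have pos_cell: "pos (gr p, col p) = p" if "p \<in> {1..n}" for p
    unfolding pos_def using inv_into_f_f[of "\<lambda>p. (gr p, col p)" "{1..n}" p] that cell_bij
    by (simp add: bij_betw_def)
  let ?A = "{(p, q) \<in> {1..n} \<times> {1..n}. p < q \<and> col p = col q}"
  let ?S = "{(u, v) \<in> U \<times> U. u < v}"
  let ?B = "SIGMA uv:?S. {1..fst (fst uv)}"
  have fin: "finite {(p, q) \<in> {1..n} \<times> {1..n}. p < q}"
    by (rule finite_subset[of _ "{1..n} \<times> {1..n}"]) auto
  have finS: "finite ?S"
    by (rule finite_subset[of _ "U \<times> U"]) auto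
  \<comment> \<open>A pair of variables in a common column corresponds to a pair of groups and that
    column. Both directions reorder, since the orders of positions and of groups need not
    agree.\<close>
  define from_cells where "from_cells = (\<lambda>((u, v), j).
    if pos (u, j) < pos (v, j) then (pos (u, j), pos (v, j)) else (pos (v, j), pos (u, j)))"
  define to_cells where "to_cells = (\<lambda>(p, q).
    if gr p < gr q then ((gr p, gr q), col p) else ((gr q, gr p), col p))"
  have gneq: "gr p \<noteq> gr q" if "p \<in> {1..n}" "q \<in> {1..n}" "p \<noteq> q" "col p = col q" for p q
    using that pos_cell by metis
  have "(\<Prod>(p, q)\<in>{(p, q) \<in> {1..n} \<times> {1..n}. p < q}.
      if col p = col q then (y (gr p) - y (gr q))\<^sup>2 else 1) = (\<Prod>(p, q)\<in>?A. (y (gr p) - y (gr q))\<^sup>2)"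
    by (rule prod.mono_neutral_cong_right[OF fin]) (auto split: if_splits)
  also have "\<dots> = (\<Prod>((u, v), j)\<in>?B. (y u - y v)\<^sup>2)"
  proof (rule prod.reindex_bij_witness[of _ from_cells to_cells])
    fix a assume "a \<in> ?A"
    then obtain p q where a: "a = (p, q)" "p \<in> {1..n}" "q \<in> {1..n}" "p < q" "col p = col q" by auto
    have ne: "gr p \<noteq> gr q" using gneq[of p q] a by simp
    show "from_cells (to_cells a) = a"
      using a pos_cell[of p] pos_cell[of q] by (auto simp: from_cells_def to_cells_def)
    show "to_cells a \<in> ?B"
      using a ne col_range[of p] col_range[of q] group_of_in[OF rp, of p] group_of_in[OF rp, of q]
      by (auto simp: to_cells_def not_less le_less)
    show "(\<lambda>((u, v), j). (y u - y v)\<^sup>2) (to_cells a) = (\<lambda>(p, q). (y (gr p) - y (gr q))\<^sup>2) a"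
      using a by (auto simp: to_cells_def power2_commute)
  next
    fix b assume "b \<in> ?B"
    then obtain u v j where b: "b = ((u, v), j)" "u \<in> U" "v \<in> U" "u < v" "1 \<le> j" "j \<le> fst u" by auto
    have "j \<le> fst v" using b(4,6) by (auto simp: less_nat_pair_iff)
    note P = pos[OF b(2,5,6)] pos[OF b(3,5) this]
    then have "pos (u, j) \<noteq> pos (v, j)" using b(4) by (metis less_irrefl)
    then show "from_cells b \<in> ?A"
      using P unfolding b(1) by (cases "pos (u, j) < pos (v, j)") (simp_all add: from_cells_def)
    have "\<not> v < u" using b(4) by simp
    then show "to_cells (from_cells b) = b"
      using P b(4) unfolding b(1)
      by (cases "pos (u, j) < pos (v, j)") (simp_all add: from_cells_def to_cells_def del: less_prod_simp)
  qed
  also have "\<dots> = (\<Prod>(u, v)\<in>?S. (y u - y v) ^ (2 * fst u))"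
    using prod.Sigma[OF finS, of "\<lambda>uv. {1..fst (fst uv)}" "\<lambda>uv _. (y (fst uv) - y (snd uv))\<^sup>2"]
    by (simp add: case_prod_beta power_mult)
  finally have 1: "(\<Prod>(p, q)\<in>{(p, q) \<in> {1..n} \<times> {1..n}. p < q}.
      if col p = col q then (y (gr p) - y (gr q))\<^sup>2 else 1) = (\<Prod>(u, v)\<in>?S. (y u - y v) ^ (2 * fst u))" .
  have "(\<Prod>p\<in>{1..n}. if b0 < col p then y (gr p) else 1) =
      (\<Prod>(u, j)\<in>cells. if b0 < j then y u else 1)"
    using prod.reindex_bij_betw[OF cell_bij, of "\<lambda>(u, j). if b0 < j then y u else 1"] by simp
  also have "\<dots> = (\<Prod>u\<in>U. \<Prod>j\<in>{1..fst u}. if b0 < j then y u else 1)"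
    by (rule prod.Sigma[symmetric]) auto
  also have "\<dots> = (\<Prod>u\<in>U. y u ^ (fst u - b0))"
  proof (rule prod.cong[OF refl])
    fix u
    have "(\<Prod>j\<in>{1..fst u}. if b0 < j then y u else 1) = (\<Prod>j\<in>{b0<..fst u}. y u)"
      by (rule prod.mono_neutral_cong_right) auto
    then show "(\<Prod>j\<in>{1..fst u}. if b0 < j then y u else 1) = y u ^ (fst u - b0)" by simp
  qed
  finally show ?thesis
    unfolding peval_disc 1 by (simp add: G_poly_eq case_prod_beta mult.commute)
qed

text \<open>A permutation under which some group meets a column twice contributes 0; by
  \<open>ex_col_perm\<close> and column symmetry every other one contributes as the identity does.
  So \<open>N\<close> is the number of the latter, positive because the identity is one of
  them.\<close>

private lemma ex_phi_symmetrization: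
  obtains N :: nat where "N > 0" "\<And>h. h \<in> col_sym \<Longrightarrow>
    phi k lam (symmetrization h) = pconst (of_nat N) * (G_poly k b0 lam * phi k lam h)"
proof -
  let ?P = "{\<sigma>. \<sigma> permutes {1..n}}"
  define good where "good = {\<sigma> \<in> ?P. inj_on (\<lambda>p. (gr (\<sigma> p), col p)) {1..n}}"
  have fin: "finite ?P" by (simp add: finite_permutations)
  have "id \<in> good" using cell_bij by (simp add: good_def permutes_id bij_betw_def)
  moreover have "finite good" using fin by (simp add: good_def)
  ultimately have "card good > 0" by (auto simp: card_gt_0_iff)
  moreover have "phi k lam (symmetrization h) = pconst (of_nat (card good)) * (G_poly k b0 lam * phi k lam h)"
    if h: "h \<in> col_sym" for h
  proof (rule peval_eqI)
    fix y :: "nat \<times> nat \<Rightarrow> complex"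
    let ?t = "\<lambda>\<sigma>. peval (\<lambda>p. y (gr (\<sigma> p))) disc * peval (\<lambda>p. y (gr (\<sigma> p))) h"
    have bad: "?t \<sigma> = 0" if "\<sigma> \<in> ?P - good" for \<sigma>
    proof -
      from that obtain p q where pq: "p \<in> {1..n}" "q \<in> {1..n}" "p \<noteq> q" "gr (\<sigma> p) = gr (\<sigma> q)" "col p = col q"
        by (auto simp: good_def inj_on_def)
      have "peval (\<lambda>p. y (gr (\<sigma> p))) disc = 0"
      proof (rule ccontr)
        assume "peval (\<lambda>p. y (gr (\<sigma> p))) disc \<noteq> 0"
        from disc_nonzero_inj[OF this pq(1-3,5)] pq(4) show False by simp
      qed
      then show ?thesis by simp
    qed
    have good: "?t \<sigma> = peval (\<lambda>p. y (gr p)) disc * peval (\<lambda>p. y (gr p)) h" if "\<sigma> \<in> good" for \<sigma>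
    proof -
      from that obtain \<pi> where \<pi>: "col_perm \<pi>" "\<And>p. p \<in> {1..n} \<Longrightarrow> gr (\<sigma> p) = gr (\<pi> p)"
        using ex_col_perm[of \<sigma>] by (auto simp: good_def)
      have "peval (\<lambda>p. y (gr (\<sigma> p))) q = peval (\<lambda>p. y (gr p)) q" if "q \<in> col_sym" for q
      proof -
        have "peval (\<lambda>p. y (gr (\<sigma> p))) q = peval (\<lambda>p. y (gr (\<pi> p))) q"
          by (rule peval_cong[of q "{1..n}"]) (use that \<pi>(2) in \<open>auto simp: col_sym_def\<close>)
        also have "\<dots> = peval (\<lambda>p. y (gr p)) q"
          by (rule col_symD[OF that \<pi>(1), of "\<lambda>p. y (gr p)"])
        finally show ?thesis .
      qed
      from this[OF disc_col_sym] this[OF h] show ?thesis by simp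
    qed
    have "peval y (phi k lam (symmetrization h)) = (\<Sum>\<sigma>\<in>?P. ?t \<sigma>)"
      by (simp add: peval_phi peval_symmetrization)
    also have "\<dots> = (\<Sum>\<sigma>\<in>good. ?t \<sigma>)"
      by (rule sum.mono_neutral_right[OF fin]) (use bad in \<open>auto simp: good_def\<close>)
    also have "\<dots> = (\<Sum>\<sigma>\<in>good. peval (\<lambda>p. y (gr p)) disc * peval (\<lambda>p. y (gr p)) h)"
      by (rule sum.cong[OF refl good])
    also have "\<dots> = of_nat (card good) * (peval y (G_poly k b0 lam) * peval y (phi k lam h))"
      by (simp add: peval_disc_group_of peval_phi)
    finally show "peval y (phi k lam (symmetrization h)) =
        peval y (pconst (of_nat (card good)) * (G_poly k b0 lam * phi k lam h))" by simp
  qed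
  ultimately show ?thesis using that by blast
qed

section \<open>Image of the column-symmetric polynomials\<close>

private lemma phi_simps: "phi k lam (pconst z) = pconst z" "phi k lam (p + q) = phi k lam p + phi k lam q"
  "phi k lam (p * q) = phi k lam p * phi k lam q"
  by (simp_all add: phi_def)

private lemma subalgebra_phi_col_sym: "subalgebra (phi k lam ` col_sym)"
proof -
  have const: "pconst z \<in> col_sym" for z by (simp add: col_sym_def)
  have closed: "p + q \<in> col_sym \<and> p * q \<in> col_sym" if "p \<in> col_sym" "q \<in> col_sym" for p q
  proof -
    have "p \<in> polys {1..n}" "q \<in> polys {1..n}" using that by (simp_all add: col_sym_def)
    moreover have "peval (\<lambda>v. x (\<pi> v)) (p + q) = peval x (p + q)"
      "peval (\<lambda>v. x (\<pi> v)) (p * q) = peval x (p * q)" if "col_perm \<pi>" for \<pi> x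
      using col_symD[OF \<open>p \<in> col_sym\<close> that, of x] col_symD[OF \<open>q \<in> col_sym\<close> that, of x] by simp_all
    ultimately show ?thesis
      unfolding col_sym_def by (intro conjI CollectI allI impI polys_add polys_mult)
  qed
  show ?thesis
    unfolding subalgebra_def
  proof (intro conjI allI ballI)
    show "pconst z \<in> phi k lam ` col_sym" for z
      by (rule image_eqI[OF _ const[of z]]) (simp add: phi_simps)
    fix p q assume "p \<in> phi k lam ` col_sym" "q \<in> phi k lam ` col_sym"
    then obtain p' q' where *: "p = phi k lam p'" "q = phi k lam q'" "p' \<in> col_sym" "q' \<in> col_sym" by blast
    show "p + q \<in> phi k lam ` col_sym"
      by (rule image_eqI[of _ _ "p' + q'"]) (simp_all add: * phi_simps closed)
    show "p * q \<in> phi k lam ` col_sym"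
      by (rule image_eqI[of _ _ "p' * q'"]) (simp_all add: * phi_simps closed)
  qed
qed

text \<open>The preimage is the power sum of the variables in column \<open>j\<close>, which each
  group of size at least \<open>j\<close> meets exactly once.\<close>

private lemma column_power_sum_mem:
  assumes "j \<ge> 1"
  shows "(\<Sum>u\<in>{u \<in> U. j \<le> fst u}. pvar u ^ r) \<in> phi k lam ` col_sym"
proof -
  define h where "h = (\<Sum>p\<in>{1..n}. if col p = j then pvar p ^ r else 0 :: nat cpoly)"
  have peval_h: "peval x h = (\<Sum>p\<in>{1..n}. if col p = j then x p ^ r else 0)" for x
    by (simp add: h_def peval_if cong: if_cong)
  have "h \<in> col_sym"
    unfolding col_sym_def
  proof (intro CollectI conjI allI impI)
    show "h \<in> polys {1..n}" unfolding h_def by (auto intro!: polys_sum polys_power)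
    fix \<pi> and x :: "nat \<Rightarrow> complex" assume "col_perm \<pi>"
    then have \<pi>: "\<pi> permutes {1..n}" and c: "\<And>p. p \<in> {1..n} \<Longrightarrow> col (\<pi> p) = col p"
      by (auto simp: col_perm_def)
    have "(\<Sum>p\<in>{1..n}. if col p = j then x (\<pi> p) ^ r else 0) =
        (\<Sum>p\<in>{1..n}. if col (\<pi> p) = j then x (\<pi> p) ^ r else 0)"
      by (rule sum.cong) (auto simp: c)
    also have "\<dots> = (\<Sum>p\<in>{1..n}. if col p = j then x p ^ r else 0)"
      using sum.permute[OF \<pi>, of "\<lambda>p. if col p = j then x p ^ r else 0"] by (simp add: comp_def)
    finally show "peval (\<lambda>p. x (\<pi> p)) h = peval x h" by (simp only: peval_h)
  qed
  moreover have "phi k lam h = (\<Sum>u\<in>{u \<in> U. j \<le> fst u}. pvar u ^ r)"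
  proof (rule peval_eqI)
    fix y :: "nat \<times> nat \<Rightarrow> complex"
    have "peval y (phi k lam h) = (\<Sum>p\<in>{1..n}. if col p = j then y (gr p) ^ r else 0)"
      by (simp only: peval_phi peval_h)
    also have "\<dots> = (\<Sum>(u, i)\<in>cells. if i = j then y u ^ r else 0)"
      using sum.reindex_bij_betw[OF cell_bij, of "\<lambda>(u, i). if i = j then y u ^ r else 0"] by simp
    also have "\<dots> = (\<Sum>u\<in>U. \<Sum>i\<in>{1..fst u}. if i = j then y u ^ r else 0)"
      by (rule sum.Sigma[symmetric]) auto
    also have "\<dots> = (\<Sum>u\<in>U. if j \<le> fst u then y u ^ r else 0)"
      by (rule sum.cong) (use assms in auto)
    also have "\<dots> = (\<Sum>u\<in>{u \<in> U. j \<le> fst u}. y u ^ r)"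
      by (rule sum.mono_neutral_cong_right) auto
    finally show "peval y (phi k lam h) = peval y (\<Sum>u\<in>{u \<in> U. j \<le> fst u}. pvar u ^ r)" by simp
  qed
  ultimately show ?thesis by (metis imageI)
qed

private lemma S_ring_subset: "S_ring k lam \<subseteq> phi k lam ` col_sym"
proof -
  let ?R = "phi k lam ` col_sym"
  note R = subalgebra_phi_col_sym
  have sub: "sym_polys ({a} \<times> {1..mult_part a lam}) \<subseteq> ?R" if a: "a \<in> {1..k}" for a
  proof (rule sym_polys_subset_subalgebra[OF _ R])
    fix r
    \<comment> \<open>Passing from column \<open>a\<close> to the next loses exactly the groups of
      block \<open>a\<close>; for \<open>a = k\<close> nothing remains.\<close>
    have split: "{u \<in> U. a \<le> fst u} = {u \<in> U. Suc a \<le> fst u} \<union> {a} \<times> {1..mult_part a lam}"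
      using a by (auto simp: index_set_def) (metis Suc_leI le_neq_implies_less)
    have "(\<Sum>u\<in>{u \<in> U. a \<le> fst u}. pvar u ^ r :: (nat \<times> nat) cpoly) =
        (\<Sum>u\<in>{u \<in> U. Suc a \<le> fst u}. pvar u ^ r) + (\<Sum>u\<in>{a} \<times> {1..mult_part a lam}. pvar u ^ r)"
      unfolding split by (rule sum.union_disjoint) auto
    then have "(\<Sum>u\<in>{a} \<times> {1..mult_part a lam}. pvar u ^ r :: (nat \<times> nat) cpoly) =
        (\<Sum>u\<in>{u \<in> U. a \<le> fst u}. pvar u ^ r) - (\<Sum>u\<in>{u \<in> U. Suc a \<le> fst u}. pvar u ^ r)"
      by simp
    also have "\<dots> \<in> ?R"
      by (intro subalgebra_diff[OF R] column_power_sum_mem) (use a in auto)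
    finally show "(\<Sum>u\<in>{a} \<times> {1..mult_part a lam}. pvar u ^ r) \<in> ?R" .
  qed simp
  show ?thesis
  proof
    fix s assume "s \<in> S_ring k lam"
    then obtain N :: nat and f where s: "s = (\<Sum>t<N. \<Prod>a=1..k. f t a)"
      and f: "\<forall>t<N. \<forall>a\<in>{1..k}. f t a \<in> sym_polys ({a} \<times> {1..mult_part a lam})"
      unfolding S_ring_def by blast
    show "s \<in> ?R"
      unfolding s by (intro subalgebra_sum[OF R] subalgebra_prod[OF R]) (use f sub in blast)
  qed
qed

lemma ideal_subset_of_columns:
  assumes "s \<in> S_ring k lam"
  shows "\<exists>f\<in>Gamma_space k b0 n lam. phi k lam f = G_poly k b0 lam * s"
proof -
  obtain N where N: "N > 0" "\<And>h. h \<in> col_sym \<Longrightarrow>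
      phi k lam (symmetrization h) = pconst (of_nat N) * (G_poly k b0 lam * phi k lam h)"
    using ex_phi_symmetrization by blast
  \<comment> \<open>Dividing by \<open>N\<close> beforehand cancels the multiplicity in the image of
    the symmetrisation.\<close>
  have "pconst (1 / of_nat N) * s \<in> phi k lam ` col_sym"
    using assms S_ring_subset subalgebra_phi_col_sym
    by (intro subalgebra_mult subalgebra_pconst) auto
  then obtain h where h: "h \<in> col_sym" "phi k lam h = pconst (1 / of_nat N) * s" by auto
  have "phi k lam (symmetrization h) = G_poly k b0 lam * s"
    unfolding N(2)[OF h(1)] h(2) by (rule peval_eqI) (use N(1) in simp)
  with symmetrization_Gamma[OF h(1)] show ?thesis by blast
qed

end

theorem corollary6p3:
  fixes k b0 n :: nat and lam :: "nat list"
  assumes "k \<ge> 1" and "b0 \<le> k" and "n \<ge> k"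
    and "restricted_partition k n lam"
  shows "phi k lam ` Gamma_space k b0 n lam = {G_poly k b0 lam * h | h. h \<in> S_ring k lam}"
proof
  show "phi k lam ` Gamma_space k b0 n lam \<subseteq> {G_poly k b0 lam * h | h. h \<in> S_ring k lam}"
    using phi_in_ideal[OF assms(1,4)] by blast
  \<comment> \<open>For the reverse inclusion, any numbering of the variables inside each group
    serves as columns.\<close>
  obtain col where "\<And>u. u \<in> index_set k lam \<Longrightarrow>
      bij_betw col {p \<in> {1..n}. group_of k lam p = u} {1..fst u}"
    using ex_columns[OF assms(4)] by blast
  from ideal_subset_of_columns[OF assms(4) this]
  show "{G_poly k b0 lam * h | h. h \<in> S_ring k lam} \<subseteq> phi k lam ` Gamma_space k b0 n lam"
    by (smt (verit) image_iff mem_Collect_eq subsetI)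
qed

end
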